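(* Let $A\in\mathbb{C}^{n\times n}$ and let $\lambda_*$ be an eigenvalue of $A$ with multiplicity support $m\times k$. Let $\mathbf{g}$ be the mapping defined in the context with proper parameters $C$ and $S$ (with respect to $A$ and $\lambda_*$) such that the matrix $X_*\in\mathbb{C}^{n\times k}$ satisfying $\mathbf{g}(A,\lambda_*,X_* )=\mathbf{0}$ has orthonormal columns. Then there are a neighborhood $\Phi$ of $(A,\lambda_* )$ in $\mathbb{C}^{n\times n}\times\mathbb{C}$ and a neighborhood $\Omega$ of a certain $\mathbf{z}_*$ in $\mathbb{C}^{n^2-mk+1}$, along with holomorphic mappings $G:\Omega\to\mathbb{C}^{n\times n}$ and $\lambda:\Omega\to\mathbb{C}$ with $(A,\lambda_* )=(G(\mathbf{z}_* ),\lambda(\mathbf{z}_* ))$, such that every $(\tilde A,\tilde\lambda)\in\Phi$ for which $\tilde\lambda$ is an eigenvalue of $\tilde A$ of multiplicity support $m\times k$ is equal to $(G(\tilde{\mathbf{z}}),\lambda(\tilde{\mathbf{z}}))$ for a certain $\tilde{\mathbf{z}}\in\Omega$. Furthermore, $$\limsup_{\mathbf{z}\to\mathbf{z}_*}\frac{|\lambda(\mathbf{z})-\lambda_*|}{\|G(\mathbf{z})-A\|_F}\;\le\;\big\|\mathbf{g}_{\lambda X}(A,\lambda_*,X_* )^\dagger\big\|_2\;<\;\infty .$$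
   Context: The multiplicity support of an eigenvalue $\lambda_*$ of a matrix $A$ is $m\times k$ if the geometric multiplicity of $\lambda_*$ is $m$ and the size of the smallest Jordan block of $A$ associated with $\lambda_*$ is $k$. For integers $m,k\le n$, let $T\in\mathbb{C}^{m\times k}$ be the matrix whose $(1,1)$ entry is $1$ and whose other entries are all $0$. Given parameters $C\in\mathbb{C}^{n\times m}$ and a strictly upper-triangular matrix $S=[s_{ij}]\in\mathbb{C}^{k\times k}$ with $s_{12}s_{23}\cdots s_{k-1,k}\neq 0$ (so $S$ is nilpotent of rank $k-1$), define $$\mathbf{g}:\mathbb{C}^{n\times n}\times\mathbb{C}\times\mathbb{C}^{n\times k}\to\mathbb{C}^{n\times k}\times\mathbb{C}^{m\times k},\qquad \mathbf{g}(G,\lambda,X)=\big((G-\lambda I)X-XS,\; C^{\mathsf H}X-T\big).$$ Here $(\cdot)^{\mathsf H}$ is the conjugate transpose. The Jacobian $\mathbf{g}_{G\lambda X}(G_0,\lambda_0,X_0)$ is the linear map $(G,\lambda,X)\mapsto\big((G-\lambda I)X_0+(G_0-\lambda_0 I)X-XS,\;C^{\mathsf H}X\big)$ on $\mathbb{C}^{n\times n}\times\mathbb{C}\times\mathbb{C}^{n\times k}$, and the partial Jacobian $\mathbf{g}_{\lambda X}(G_0,\lambda_0,X_0)$ is the linear map $(\lambda,X)\mapsto\big(-\lambda X_0+(G_0-\lambda_0 I)X-XS,\;C^{\mathsf H}X\big)$ on $\mathbb{C}\times\mathbb{C}^{n\times k}$. The parameters $C,S$ are called proper (with respect to $A$ and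 $\lambda_*$) if there is an $X_*\in\mathbb{C}^{n\times k}$ with $\mathbf{g}(A,\lambda_*,X_* )=\mathbf{0}$ such that $\mathbf{g}_{G\lambda X}(A,\lambda_*,X_* )$ is surjective and $\mathbf{g}_{\lambda X}(A,\lambda_*,X_* )$ is injective; such an $X_*$ is then unique. Product spaces carry the Euclidean norm (square root of the sum of squared moduli of all components), denoted $\|\cdot\|_2$; the norm $\|\cdot\|_2$ of a linear map is the induced operator norm, and $(\cdot)^\dagger$ is the Moore-Penrose inverse with respect to these Euclidean structures. $\|\cdot\|_F$ is the Frobenius norm. *)

theory Defs
  imports "HOL-Analysis.Analysis" "Jordan_Normal_Form.Jordan_Normal_Form"
begin

no_notation Matrix.vec_index (infixl \<open>$\<close> 100)

type_synonym ('p, 'q) cmat = "((complex, 'q) Finite_Cartesian_Product.vec, 'p) Finite_Cartesian_Product.vec"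

text \<open>
  \<open>('p, 'q) cmat\<close>, which is \<open>complex^'q^'p\<close>, is the type of complex matrices with \<open>CARD('p)\<close> rows
  and \<open>CARD('q)\<close> columns. Its library norm is the Frobenius norm; likewise the library norms on
  product types are the Euclidean ones. Where the order of rows or columns matters, the index
  types are finite well-orders, and \<open>idx i\<close> is the index in position \<open>i\<close>, counting from 0. It is
  meaningful for \<open>i < CARD('a)\<close> only.
\<close>

definition idx :: "nat \<Rightarrow> 'a::{finite,wellorder}" where
  "idx i = Infinite_Set.enumerate UNIV i"

definition to_mat :: "('n, 'n::{finite,wellorder}) cmat \<Rightarrow> complex Matrix.mat" where
  "to_mat A = Matrix.mat CARD('n) CARD('n) (\<lambda>(i, j). A $ idx i $ idx j)"

definition eigenspace :: "('n, 'n::finite) cmat \<Rightarrow> complex \<Rightarrow> (complex^'n) set" where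
  "eigenspace A l = {v. A *v v = l *s v}"

definition is_eigenvalue :: "('n, 'n::finite) cmat \<Rightarrow> complex \<Rightarrow> bool" where
  "is_eigenvalue A l \<longleftrightarrow> (\<exists>v \<in> eigenspace A l. v \<noteq> 0)"

text \<open>The Jordan normal form is unique up to the order of its blocks, so its choice is immaterial.\<close>

definition multiplicity_support ::
    "('n, 'n::{finite,wellorder}) cmat \<Rightarrow> complex \<Rightarrow> nat \<Rightarrow> nat \<Rightarrow> bool" where
  "multiplicity_support A l m k \<longleftrightarrow>
     is_eigenvalue A l \<and>
     vec.dim (eigenspace A l) = m \<and>
     (\<exists>blocks. jordan_nf (to_mat A) blocks \<and> Min {j. (j, l) \<in> set blocks} = k)"

definition herm :: "('p::finite, 'q::finite) cmat \<Rightarrow> ('q, 'p) cmat" where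
  "herm M = (\<chi> i j. cnj (M $ j $ i))"

definition orthonormal_columns :: "('p::finite, 'q::finite) cmat \<Rightarrow> bool" where
  "orthonormal_columns M \<longleftrightarrow> herm M ** M = Finite_Cartesian_Product.mat 1"

definition corner :: "('m::{finite,wellorder}, 'k::{finite,wellorder}) cmat" where
  "corner = (\<chi> i j. if i = idx 0 \<and> j = idx 0 then 1 else 0)"

definition strictly_upper_triangular :: "('k, 'k::{finite,wellorder}) cmat \<Rightarrow> bool" where
  "strictly_upper_triangular S \<longleftrightarrow> (\<forall>i j. j \<le> i \<longrightarrow> S $ i $ j = 0)"

definition superdiagonal_prod :: "('k, 'k::{finite,wellorder}) cmat \<Rightarrow> complex" where
  "superdiagonal_prod S = (\<Prod>i<CARD('k) - 1. S $ idx i $ idx (Suc i))"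

text \<open>Below, \<open>Finite_Cartesian_Product.mat l\<close> is \<open>l\<close> times the identity matrix.\<close>

definition g_map ::
    "('n::finite, 'm) cmat \<Rightarrow> ('k, 'k) cmat \<Rightarrow>
     ('n, 'n) cmat \<times> complex \<times> ('n, 'k) cmat \<Rightarrow>
     ('n, 'k::{finite,wellorder}) cmat \<times> ('m::{finite,wellorder}, 'k) cmat" where
  "g_map C S = (\<lambda>(G, l, X).
     ((G - Finite_Cartesian_Product.mat l) ** X - X ** S, herm C ** X - corner))"

definition g_jac ::
    "('n::finite, 'm::finite) cmat \<Rightarrow> ('k, 'k::finite) cmat \<Rightarrow>
     ('n, 'n) cmat \<times> complex \<times> ('n, 'k) cmat \<Rightarrow>
     ('n, 'n) cmat \<times> complex \<times> ('n, 'k) cmat \<Rightarrow>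
     ('n, 'k) cmat \<times> ('m, 'k) cmat" where
  "g_jac C S = (\<lambda>(G0, l0, X0) (G, l, X).
     ((G - Finite_Cartesian_Product.mat l) ** X0
        + (G0 - Finite_Cartesian_Product.mat l0) ** X - X ** S,
      herm C ** X))"

definition g_partial_jac ::
    "('n::finite, 'm::finite) cmat \<Rightarrow> ('k, 'k::finite) cmat \<Rightarrow>
     ('n, 'n) cmat \<times> complex \<times> ('n, 'k) cmat \<Rightarrow>
     complex \<times> ('n, 'k) cmat \<Rightarrow>
     ('n, 'k) cmat \<times> ('m, 'k) cmat" where
  "g_partial_jac C S = (\<lambda>(G0, l0, X0) (l, X).
     (- (Finite_Cartesian_Product.mat l ** X0)
        + (G0 - Finite_Cartesian_Product.mat l0) ** X - X ** S,
      herm C ** X))"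

definition proper_parameters ::
    "('n, 'n::finite) cmat \<Rightarrow> complex \<Rightarrow>
     ('n, 'm::{finite,wellorder}) cmat \<Rightarrow> ('k, 'k::{finite,wellorder}) cmat \<Rightarrow> bool" where
  "proper_parameters A l C S \<longleftrightarrow>
     (\<exists>X. g_map C S (A, l, X) = 0 \<and>
          surj (g_jac C S (A, l, X)) \<and>
          inj (g_partial_jac C S (A, l, X)))"

text \<open>
  The four Penrose conditions. The library inner product on a complex coordinate space is the
  real part of the Hermitian one; for a complex-linear map, being self-adjoint with respect to
  either is the same, and the unique \<open>P\<close> below is complex-linear if \<open>L\<close> is.
\<close>

definition is_pseudoinverse ::
    "('a::real_inner \<Rightarrow> 'b::real_inner) \<Rightarrow> ('b \<Rightarrow> 'a) \<Rightarrow> bool" where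
  "is_pseudoinverse L P \<longleftrightarrow>
     linear P \<and>
     (\<forall>x. L (P (L x)) = L x) \<and>
     (\<forall>y. P (L (P y)) = P y) \<and>
     (\<forall>y y'. L (P y) \<bullet> y' = y \<bullet> L (P y')) \<and>
     (\<forall>x x'. P (L x) \<bullet> x' = x \<bullet> P (L x'))"

definition pseudoinverse :: "('a::real_inner \<Rightarrow> 'b::real_inner) \<Rightarrow> 'b \<Rightarrow> 'a" where
  "pseudoinverse L = (THE P. is_pseudoinverse L P)"

text \<open>
  The induced operator norm with values in the extended reals, so that its finiteness is a
  genuine assertion. The vector \<open>0\<close> contributes \<open>0\<close> to the supremum.
\<close>

definition operator_norm :: "('a::real_normed_vector \<Rightarrow> 'b::real_normed_vector) \<Rightarrow> ereal" where
  "operator_norm f = (SUP x. ereal (norm (f x) / norm x))"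

text \<open>
  Holomorphy in several variables is complex Frechet differentiability at every point;
  for matrix-valued functions it is required of every entry.
\<close>

definition holomorphic_several :: "(complex^'z \<Rightarrow> complex) \<Rightarrow> (complex^'z) set \<Rightarrow> bool" where
  "holomorphic_several f U \<longleftrightarrow>
     (\<forall>z\<in>U. \<exists>D. (f has_derivative D) (at z) \<and> (\<forall>c v. D (c *s v) = c * D v))"

definition holomorphic_several_mat ::
    "(complex^'z \<Rightarrow> ('p::finite, 'q::finite) cmat) \<Rightarrow> (complex^'z) set \<Rightarrow> bool" where
  "holomorphic_several_mat F U \<longleftrightarrow> (\<forall>i j. holomorphic_several (\<lambda>z. F z $ i $ j) U)"

end

theory Submission
  imports Defs "Jordan_Normal_Form.Jordan_Normal_Form_Uniqueness"
begin

no_notation Matrix.vec_index (infixl \<open>$\<close> 100)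
no_notation scalar_prod (infix \<open>\<bullet>\<close> 70)

text \<open>
  Near \<open>(A, \<lambda>\<^sub>*, X\<^sub>*)\<close> the zero set of \<open>g\<close> is a complex manifold of dimension
  \<open>n\<^sup>2 - m k + 1\<close>, because the full Jacobian is surjective; the inverse function theorem, applied
  to \<open>g\<close> completed by linear coordinates \<open>R\<close> on the kernel of the Jacobian, parametrizes it
  holomorphically.

  If \<open>B\<close> has the eigenvalue \<open>\<mu>\<close> with multiplicity support \<open>m \<times> k\<close>, all \<open>m\<close> Jordan blocks have size
  at least \<open>k\<close>, so the kernel of \<open>(B - \<mu> I)\<^sup>k\<close> has dimension \<open>m k\<close>, and so has the space of
  solutions of \<open>(B - \<mu> I) Y = Y S\<close>. For \<open>(B, \<mu>)\<close> near \<open>(A, \<lambda>\<^sub>*)\<close> the map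
  \<open>Y \<mapsto> C\<^sup>H Y\<close> stays injective on this space, hence reaches \<open>T\<close>, and its solution is near
  \<open>X\<^sub>*\<close> since injective linear maps are bounded below. So \<open>(B, \<mu>)\<close> lies on the manifold.

  For the bound, subtracting \<open>g = 0\<close> at \<open>z\<close> and at \<open>z\<^sub>*\<close> gives
  \<open>g\<^bsub>\<lambda>X\<^esub> (\<Delta>\<lambda>, \<Delta>X) = (\<Delta>\<lambda> \<Delta>X - \<Delta>G \<Delta>X - \<Delta>G X\<^sub>*, 0)\<close>; apply the pseudoinverse, a left inverse,
  and use that multiplication by the orthonormal columns \<open>X\<^sub>*\<close> does not increase the Frobenius norm.
\<close>

section \<open>Kernels of powers and the Jordan form\<close>

lemma bij_betw_idx: "bij_betw (idx :: nat \<Rightarrow> 'a::{finite,wellorder}) {..<CARD('a)} UNIV"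
  unfolding idx_def[abs_def] lessThan_atLeast0
  using finite_bij_enumerate[of "UNIV :: 'a set"] by (simp add: lessThan_atLeast0)

lemma sum_idx: "(\<Sum>i\<in>UNIV. f i) = (\<Sum>i=0..<CARD('a). f (idx i :: 'a::{finite,wellorder}))"
  using sum.reindex_bij_betw[OF bij_betw_idx, of f] by (simp add: lessThan_atLeast0)

lemma idx_eq_iff: "i < CARD('a) \<Longrightarrow> j < CARD('a) \<Longrightarrow> idx i = (idx j :: 'a::{finite,wellorder}) \<longleftrightarrow> i = j"
  using bij_betw_imp_inj_on[OF bij_betw_idx] by (auto simp: inj_on_def)

lemma idx_surj: obtains i where "i < CARD('a)" "x = (idx i :: 'a::{finite,wellorder})"
  using bij_betw_imp_surj_on[OF bij_betw_idx[where 'a='a]] by (metis UNIV_I imageE lessThan_iff)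

lemma all_idx: "(\<forall>x :: 'a::{finite,wellorder}. P x) \<longleftrightarrow> (\<forall>i<CARD('a). P (idx i))"
  by (metis idx_surj)

section \<open>Passage from indexed vectors and matrices to their carrier-based counterparts\<close>

definition to_vec :: "complex^'n::{finite,wellorder} \<Rightarrow> complex Matrix.vec" where
  "to_vec v = Matrix.vec CARD('n) (\<lambda>i. v $ idx i)"

lemma to_vec_carrier: "to_vec v \<in> carrier_vec CARD('n)" for v :: "complex^'n::{finite,wellorder}"
  by (simp add: to_vec_def)

lemma to_vec_index: "i < CARD('n) \<Longrightarrow> Matrix.vec_index (to_vec v) i = v $ idx i"
  for v :: "complex^'n::{finite,wellorder}"
  by (simp add: to_vec_def)

lemma vec_eq_iff_idx: "v = w \<longleftrightarrow> (\<forall>i<CARD('n). v $ idx i = w $ idx i)"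
  for v :: "'b^'n::{finite,wellorder}"
  unfolding Finite_Cartesian_Product.vec_eq_iff by (rule all_idx)

lemma inj_to_vec: "inj to_vec"
  by (rule injI) (metis to_vec_index vec_eq_iff_idx)

lemma to_vec_surj:
  assumes "w \<in> carrier_vec CARD('n::{finite,wellorder})"
  obtains v :: "complex^'n::{finite,wellorder}" where "w = to_vec v"
proof
  let ?v = "\<chi> i. Matrix.vec_index w (inv_into {..<CARD('n)} idx i) :: complex^'n::{finite,wellorder}"
  have "inv_into {..<CARD('n)} idx (idx i :: 'n) = i" if "i < CARD('n)" for i
    using bij_betw_inv_into_left[OF bij_betw_idx, of i] that by auto
  then show "w = to_vec ?v"
    using assms by (intro eq_vecI) (auto simp: to_vec_def)
qed

lemma to_mat_carrier: "to_mat A \<in> carrier_mat CARD('n) CARD('n)"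
  for A :: "('n, 'n::{finite,wellorder}) cmat"
  by (simp add: to_mat_def)

lemma to_mat_mult_vec: "to_mat A *\<^sub>v to_vec v = to_vec (A *v v)"
  by (intro eq_vecI)
     (auto simp: to_mat_def to_vec_def matrix_vector_mult_def scalar_prod_def sum_idx)

lemma to_mat_mult: "to_mat A * to_mat B = to_mat (A ** B)"
  by (intro eq_matI)
     (auto simp: to_mat_def matrix_matrix_mult_def scalar_prod_def sum_idx)

lemma to_mat_one: "to_mat (Finite_Cartesian_Product.mat 1 :: ('n, 'n::{finite,wellorder}) cmat) = 1\<^sub>m CARD('n)"
  by (intro eq_matI) (auto simp: to_mat_def Finite_Cartesian_Product.mat_def idx_eq_iff)

lemma char_matrix_to_mat: "char_matrix (to_mat A) l = to_mat (A - Finite_Cartesian_Product.mat l)"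
  by (intro eq_matI)
     (auto simp: char_matrix_def to_mat_def Finite_Cartesian_Product.mat_def idx_eq_iff)

text \<open>Multiplying on the right follows the recursion of \<open>^\<^sub>m\<close>, so that
  \<open>to_mat_pow\<close> is a direct induction.\<close>

abbreviation matpow :: "('n, 'n::finite) cmat \<Rightarrow> nat \<Rightarrow> ('n, 'n) cmat" where
  "matpow N j \<equiv> ((\<lambda>M. M ** N) ^^ j) (Finite_Cartesian_Product.mat 1)"

lemma to_mat_pow: "to_mat N ^\<^sub>m j = to_mat (matpow N j)"
  by (induction j)
     (simp_all add: to_mat_one to_mat_mult, simp add: to_mat_def)

text \<open>The injection \<open>to_vec\<close> carries a basis of the kernel to a basis of
  \<open>mat_kernel\<close>, so both dimensions are the cardinality of that basis. This makes
  results on the Jordan form available for \<open>vec.dim\<close>.\<close>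

lemma dim_kernel_eq_kernel_dim:
  fixes A :: "('n, 'n::{finite,wellorder}) cmat"
  shows "vec.dim {v. A *v v = 0} = kernel_dim (to_mat A)"
proof -
  let ?n = "CARD('n)" and ?K = "{v. A *v v = 0}"
  interpret ker: kernel ?n ?n "to_mat A"
    by unfold_locales (rule to_mat_carrier)
  obtain B where B: "B \<subseteq> ?K" "vec.independent B" "?K \<subseteq> vec.span B" "card B = vec.dim ?K"
    using vec.basis_exists by metis
  have finB: "finite B" using B(2) vec.finiteI_independent by blast
  have zero: "to_vec (0 :: complex^'n::{finite,wellorder}) = 0\<^sub>v ?n"
    by (auto simp: to_vec_def)
  have inj: "inj_on to_vec U" for U :: "(complex^'n::{finite,wellorder}) set"
    using inj_to_vec inj_on_subset by blast
  have ker_eq: "mat_kernel (to_mat A) = to_vec ` ?K"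
    unfolding mat_kernel[OF to_mat_carrier]
    by (auto simp: to_mat_mult_vec zero to_vec_carrier elim!: to_vec_surj)
       (metis (mono_tags, lifting) image_eqI inj_eq inj_to_vec mem_Collect_eq to_mat_mult_vec zero)
  \<comment> \<open>On the carrier side the coefficients are functions of the images, hence
    \<open>a (to_vec b)\<close>. Independence and spanning are both transported by this
    identity.\<close>
  have lincomb: "ker.Ker.lincomb a (to_vec ` U) = to_vec (\<Sum>b\<in>U. a (to_vec b) *s b)"
    if U: "U \<subseteq> ?K" for a U
  proof (intro eq_vecI)
    have sub: "to_vec ` U \<subseteq> mat_kernel (to_mat A)" using U ker_eq by auto
    have "ker.Ker.lincomb a (to_vec ` U) \<in> mat_kernel (to_mat A)"
      by (rule ker.Ker.lincomb_closed[OF sub]) simp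
    then have "ker.Ker.lincomb a (to_vec ` U) \<in> carrier_vec ?n"
      using mat_kernel_carrier[OF to_mat_carrier] by blast
    then show "dim_vec (ker.Ker.lincomb a (to_vec ` U)) = dim_vec (to_vec (\<Sum>b\<in>U. a (to_vec b) *s b))"
      by (simp add: to_vec_def)
    fix i assume "i < dim_vec (to_vec (\<Sum>b\<in>U. a (to_vec b) *s b))"
    then have i: "i < ?n" by (simp add: to_vec_def)
    show "Matrix.vec_index (ker.Ker.lincomb a (to_vec ` U)) i
      = Matrix.vec_index (to_vec (\<Sum>b\<in>U. a (to_vec b) *s b)) i"
      unfolding ker.lincomb_index[OF i sub] to_vec_index[OF i]
      by (simp add: sum.reindex[OF inj] to_vec_index[OF i])
  qed
  have "ker.Ker.basis (to_vec ` B)"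
    unfolding ker.Ker.basis_def
  proof (intro conjI)
    show sub: "to_vec ` B \<subseteq> mat_kernel (to_mat A)" using B(1) ker_eq by auto
    show "\<not> ker.Ker.lin_dep (to_vec ` B)"
    proof
      assume "ker.Ker.lin_dep (to_vec ` B)"
      then obtain U a v where U: "finite U" "U \<subseteq> to_vec ` B" "ker.Ker.lincomb a U = 0\<^sub>v ?n"
        "v \<in> U" "a v \<noteq> 0"
        unfolding ker.Ker.lin_dep_def by auto
      obtain B' where B': "B' \<subseteq> B" "U = to_vec ` B'"
        using U(2) by (metis subset_imageE)
      have "to_vec (\<Sum>b\<in>B'. a (to_vec b) *s b) = to_vec (0 :: complex^'n::{finite,wellorder})"
        using lincomb[of B' a] B B' U(3) zero by auto
      then have eq: "(\<Sum>b\<in>B'. a (to_vec b) *s b) = 0"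
        using inj_to_vec by (auto dest: injD)
      obtain b where "b \<in> B'" "v = to_vec b" using U(4) B' by auto
      then show False
        using vec.independentD[OF B(2) _ B'(1) eq, of b] finite_subset[OF B'(1) finB] U(5) by auto
    qed
    show "ker.Ker.span (to_vec ` B) = mat_kernel (to_mat A)"
    proof
      show "ker.Ker.span (to_vec ` B) \<subseteq> mat_kernel (to_mat A)"
        using sub by (rule ker.Ker.span_is_subset2)
      show "mat_kernel (to_mat A) \<subseteq> ker.Ker.span (to_vec ` B)"
      proof
        fix w assume "w \<in> mat_kernel (to_mat A)"
        then obtain v where v: "v \<in> ?K" "w = to_vec v" using ker_eq by auto
        then obtain u where u: "v = (\<Sum>b\<in>B. u b *s b)"
          using B(3) vec.span_finite[OF finB] by auto
        have "w = ker.Ker.lincomb (u \<circ> inv_into UNIV to_vec) (to_vec ` B)"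
          using lincomb[OF B(1), of "u \<circ> inv_into UNIV to_vec"] u v by (simp add: inv_f_f[OF inj_to_vec])
        then show "w \<in> ker.Ker.span (to_vec ` B)"
          unfolding ker.Ker.span_def using finB by auto
      qed
    qed
  qed
  then have "ker.Ker.dim = card (to_vec ` B)"
    using ker.Ker.dim_basis finB by blast
  then show ?thesis
    using B(4) card_image[OF inj] by simp
qed

text \<open>A Jordan block of size \<open>n\<close> for \<open>l\<close> contributes
  \<open>min j n\<close> to the dimension of the kernel of the \<open>j\<close>-th power. At
  \<open>j = 1\<close> this counts the blocks, so there are \<open>m\<close> of them; at
  \<open>j = k\<close> each contributes exactly \<open>k\<close>, because none is smaller.\<close>

lemma dim_kernel_power_if_multiplicity_support:
  fixes B :: "('n, 'n::{finite,wellorder}) cmat"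
  assumes "multiplicity_support B l m k" "m > 0"
  shows "vec.dim {v. matpow (B - Finite_Cartesian_Product.mat l) k *v v = 0} = m * k"
proof -
  let ?N = "B - Finite_Cartesian_Product.mat l"
  obtain bl where bl: "jordan_nf (to_mat B) bl" "Min {j. (j, l) \<in> set bl} = k"
    and m: "vec.dim (eigenspace B l) = m"
    using assms by (auto simp: multiplicity_support_def)
  \<comment> \<open>A list rather than a set, so that blocks of equal size are counted
    separately.\<close>
  define ns where "ns = map fst [(n, e)\<leftarrow>bl. e = l]"
  have dim: "vec.dim {v. matpow ?N j *v v = 0} = (\<Sum>n\<leftarrow>ns. min j n)" for j
    using dim_gen_eigenspace[OF bl(1), of l j]
    by (simp add: dim_gen_eigenspace_def char_matrix_to_mat to_mat_pow dim_kernel_eq_kernel_dim ns_def)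
  have "{v. matpow ?N 1 *v v = 0} = eigenspace B l"
    by (simp add: eigenspace_def matrix_vector_mult_diff_rdistrib) 
       (simp add: matrix_vector_mult_def Finite_Cartesian_Product.mat_def Finite_Cartesian_Product.vec_eq_iff
        if_distrib if_distribR cong: if_cong)
  \<comment> \<open>\<open>jordan_nf\<close> excludes empty blocks, so each block counts exactly
    once at exponent 1.\<close>
  moreover have pos: "n \<ge> 1" if "n \<in> set ns" for n
  proof -
    have "0 \<notin> fst ` set bl" using bl(1) by (auto simp: jordan_nf_def)
    then show ?thesis using that by (force simp: ns_def)
  qed
  then have "(\<Sum>n\<leftarrow>ns. min 1 n) = length ns"
    by (induction ns) auto
  ultimately have len: "length ns = m"
    using dim[of 1] m by simp
  have set_ns: "set ns = {j. (j, l) \<in> set bl}"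
    by (force simp: ns_def)
  have "k \<le> n" if "n \<in> set ns" for n
    using that bl(2) set_ns by (metis List.finite_set Min_le)
  then have "(\<Sum>n\<leftarrow>ns. min k n) = length ns * k"
    by (induction ns) auto
  then show ?thesis
    using dim[of k] len by simp
qed

section \<open>The equation \<open>N X = X S\<close>\<close>

definition pos :: "'a::{finite,wellorder} \<Rightarrow> nat" where
  "pos = inv_into {..<CARD('a)} idx"

lemma pos_idx: "i < CARD('a) \<Longrightarrow> pos (idx i :: 'a::{finite,wellorder}) = i"
  unfolding pos_def using bij_betw_inv_into_left[OF bij_betw_idx, of i] by auto

lemma pos_less: "pos (i :: 'a::{finite,wellorder}) < CARD('a)"
  by (metis idx_surj pos_idx)

lemma idx_mono: "i \<le> j \<Longrightarrow> j < CARD('a) \<Longrightarrow> idx i \<le> (idx j :: 'a::{finite,wellorder})"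
  using finite_enumerate_mono[of i j "UNIV :: 'a set"]
  by (cases "i = j") (auto simp: idx_def intro: less_imp_le)

lemma idx_zero_le: "idx 0 \<le> (i :: 'a::{finite,wellorder})"
  by (metis idx_mono idx_surj le0)

lemma matpow_mult_vec: "matpow N j *v v = ((*v) N ^^ j) v"
proof (induction j arbitrary: v)
  case (Suc j)
  then show ?case
    by (simp add: matrix_vector_mul_assoc[symmetric] funpow_swap1)
qed simp

section \<open>Krylov matrices and the nilpotent matrix \<open>S\<close>\<close>

definition krylov :: "('n, 'n::finite) cmat \<Rightarrow> complex^'n \<Rightarrow> ('n, 'k::{finite,wellorder}) cmat" where
  "krylov N v = (\<chi> i j. ((*v) N ^^ pos j) v $ i)"

text \<open>The nilpotent Jordan block with ones below the diagonal: as a right factor it moves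
  every column one place to the left and fills the last one with zeros.\<close>

definition shift :: "('k, 'k::{finite,wellorder}) cmat" where
  "shift = (\<chi> i j. if pos i = Suc (pos j) then 1 else 0)"

lemma mult_shift: "(M ** shift) $ i $ j =
    (if Suc (pos j) < CARD('k) then M $ i $ idx (Suc (pos j)) else 0)"
  for M :: "('n::finite, 'k::{finite,wellorder}) cmat"
proof -
  have "(M ** shift) $ i $ j = (\<Sum>l = 0..<CARD('k). if l = Suc (pos j) then M $ i $ idx l else 0)"
    by (simp add: matrix_matrix_mult_def shift_def sum_idx pos_idx if_distrib cong: if_cong)
  then show ?thesis by auto
qed

text \<open>\<open>N\<close> sends each Krylov column to the next one, and the assumption says that
  it kills the last.\<close>

lemma krylov_shift:
  fixes N :: "('n, 'n::finite) cmat"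
  assumes "((*v) N ^^ CARD('k)) v = 0"
  shows "N ** krylov N v = krylov N v ** (shift :: ('k, 'k::{finite,wellorder}) cmat)"
proof -
  have "(N ** krylov N v) $ i $ j = ((*v) N ^^ Suc (pos j)) v $ i" for i and j :: 'k
    by (simp add: matrix_matrix_mult_def krylov_def matrix_vector_mult_def)
  moreover have "((*v) N ^^ Suc (pos j)) v = 0" if "\<not> Suc (pos j) < CARD('k)" for j :: 'k
    using assms that pos_less[of j] by (metis Suc_lessI)
  ultimately show ?thesis
    by (simp add: Finite_Cartesian_Product.vec_eq_iff mult_shift) (simp add: krylov_def pos_idx)
qed

context
  fixes S :: "('k, 'k::{finite,wellorder}) cmat"
  assumes upper: "strictly_upper_triangular S"
    and super: "superdiagonal_prod S \<noteq> 0"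
begin

abbreviation (input) "last_axis \<equiv> axis (idx (CARD('k) - 1)) 1 :: (complex, 'k) Finite_Cartesian_Product.vec"

text \<open>Each application of \<open>S\<close> moves the last nonzero entry up by exactly one
  position: strict triangularity clears everything below, and the superdiagonal entry met on the way
  is nonzero.\<close>

lemma funpow_last_axis:
  assumes "j < CARD('k)"
  shows "(\<forall>i<CARD('k). CARD('k) - 1 - j < i \<longrightarrow> ((*v) S ^^ j) last_axis $ idx i = 0) \<and>
    ((*v) S ^^ j) last_axis $ idx (CARD('k) - 1 - j) \<noteq> 0"
  using assms
proof (induction j)
  case 0
  then show ?case by (auto simp: axis_def idx_eq_iff)
next
  case (Suc j)
  let ?w = "((*v) S ^^ j) last_axis" and ?p = "CARD('k) - 1 - j"
  have expand: "((*v) S ^^ Suc j) last_axis $ x = (\<Sum>l=0..<CARD('k). S $ x $ idx l * ?w $ idx l)" for x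
    by (simp add: matrix_vector_mult_def sum_idx)
  \<comment> \<open>Terms with \<open>l \<le> i\<close> vanish by triangularity, those beyond
    \<open>?p\<close> by the induction hypothesis. For \<open>i = ?p - 1\<close> only
    \<open>l = ?p\<close> survives.\<close>
  have *: "S $ idx i $ idx l * ?w $ idx l = 0" if "i < CARD('k)" "l < CARD('k)" "l \<le> i \<or> ?p < l" for i l
    using that Suc upper by (auto simp: strictly_upper_triangular_def idx_mono)
  show ?case
  proof (intro conjI allI impI)
    fix i assume "i < CARD('k)" "CARD('k) - 1 - Suc j < i"
    then show "((*v) S ^^ Suc j) last_axis $ idx i = 0"
      unfolding expand using Suc.prems by (intro sum.neutral ballI *) auto
  next
    let ?i = "CARD('k) - 1 - Suc j"
    have p: "?p = Suc ?i" "?p < CARD('k)" using Suc.prems by auto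
    have "((*v) S ^^ Suc j) last_axis $ idx ?i
        = (\<Sum>l=0..<CARD('k). if l = ?p then S $ idx ?i $ idx ?p * ?w $ idx ?p else 0)"
      unfolding expand
    proof (rule sum.cong[OF refl])
      fix l assume "l \<in> {0..<CARD('k)}"
      then show "S $ idx ?i $ idx l * ?w $ idx l
          = (if l = ?p then S $ idx ?i $ idx ?p * ?w $ idx ?p else 0)"
      proof (cases "l = ?p")
        case False
        then have "l \<le> ?i \<or> ?p < l" using p by linarith
        then have "S $ idx ?i $ idx l * ?w $ idx l = 0"
          using \<open>l \<in> _\<close> p by (intro *) auto
        then show ?thesis using False by simp
      qed simp
    qed
    also have "\<dots> = S $ idx ?i $ idx ?p * ?w $ idx ?p"
      using p by simp
    also have "\<dots> \<noteq> 0"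
    proof -
      have "S $ idx ?i $ idx (Suc ?i) \<noteq> 0"
        using super p Suc.prems unfolding superdiagonal_prod_def by (simp add: prod_zero_iff)
      then show ?thesis using Suc p by auto
    qed
    finally show "((*v) S ^^ Suc j) last_axis $ idx ?i \<noteq> 0" .
  qed
qed

text \<open>One step earlier at most the entry in position 0 is left, and the first column of
  \<open>S\<close> is zero.\<close>

lemma funpow_card_last_axis: "((*v) S ^^ CARD('k)) last_axis = 0"
proof -
  define j where "j = CARD('k) - 1"
  have K: "CARD('k) = Suc j" "j < CARD('k)" by (simp_all add: j_def)
  let ?w = "((*v) S ^^ j) last_axis"
  have w: "?w $ idx l = 0" if "0 < l" "l < CARD('k)" for l
    using funpow_last_axis[OF K(2)] that by (simp add: K(1))
  have *: "S $ idx i $ idx l * ?w $ idx l = 0" if "l < CARD('k)" for i l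
    using that w upper by (cases "l = 0") (auto simp: strictly_upper_triangular_def idx_zero_le)
  have "(S *v ?w) $ idx i = (\<Sum>l=0..<CARD('k). S $ idx i $ idx l * ?w $ idx l)" for i
    by (simp add: matrix_vector_mult_def sum_idx)
  moreover have "(\<Sum>l=0..<CARD('k). S $ idx i $ idx l * ?w $ idx l) = 0" for i
    by (intro sum.neutral ballI *) auto
  ultimately show ?thesis
    unfolding vec_eq_iff_idx K(1) by simp
qed

text \<open>With its rows in reverse order the matrix is lower triangular with nonzero diagonal, so
  forward substitution shows that its kernel is trivial.\<close>

lemma invertible_krylov: "invertible (krylov S last_axis :: ('k, 'k) cmat)"
proof -
  let ?W = "krylov S last_axis :: ('k, 'k) cmat"
  have "c = 0" if c: "?W *v c = 0" for c
  proof -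
    have "c $ idx j = 0" if "j < CARD('k)" for j
      using that
    proof (induction j rule: less_induct)
      case (less j)
      \<comment> \<open>Row \<open>?p\<close> isolates the coefficient in position \<open>j\<close>:
        earlier coefficients are already zero, and later columns vanish in this row.\<close>
      let ?p = "CARD('k) - 1 - j"
      have "((*v) S ^^ l) last_axis $ idx ?p * c $ idx l = 0" if "l < CARD('k)" "l \<noteq> j" for l
      proof (cases "l < j")
        case False
        then have "((*v) S ^^ l) last_axis $ idx ?p = 0"
          using funpow_last_axis[OF \<open>l < CARD('k)\<close>] that by auto
        then show ?thesis by simp
      qed (use less that in auto)
      then have "(\<Sum>l=0..<CARD('k). ((*v) S ^^ l) last_axis $ idx ?p * c $ idx l)
        = (\<Sum>l=0..<CARD('k). if l = j then ((*v) S ^^ j) last_axis $ idx ?p * c $ idx j else 0)"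
        by (intro sum.cong) auto
      moreover have "(?W *v c) $ idx ?p = (\<Sum>l=0..<CARD('k). ((*v) S ^^ l) last_axis $ idx ?p * c $ idx l)"
        by (simp add: matrix_vector_mult_def krylov_def sum_idx pos_idx)
      ultimately show ?case
        using c less.prems funpow_last_axis[OF less.prems] by simp
    qed
    then show ?thesis by (simp add: vec_eq_iff_idx)
  qed
  then have "\<exists>B. B ** ?W = Finite_Cartesian_Product.mat 1"
    unfolding matrix_left_invertible_ker by blast
  then show ?thesis
    by (simp add: invertible_left_inverse)
qed

text \<open>If \<open>N\<^sup>k v = 0\<close> and \<open>e\<close> is the last unit vector, both Krylov matrices
  \<open>V = [v, N v, \<dots>]\<close> and \<open>W = [e, S e, \<dots>]\<close> intertwine with the shift, so \<open>X = V W\<^sup>-\<^sup>1\<close>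
  satisfies \<open>N X = X S\<close>. These \<open>X\<close> form a space of the dimension of the right-hand sides \<open>T\<close>.\<close>

lemma intertwining_solution_exists:
  fixes N :: "('n, 'n::{finite,wellorder}) cmat" and C :: "('n, 'm::finite) cmat"
    and T :: "('m, 'k) cmat"
  assumes dim: "vec.dim {v. matpow N CARD('k) *v v = 0} = CARD('m) * CARD('k)"
    and inj: "\<And>X :: ('n, 'k) cmat. N ** X - X ** S = 0 \<Longrightarrow> herm C ** X = 0 \<Longrightarrow> X = 0"
  shows "\<exists>X. N ** X - X ** S = 0 \<and> herm C ** X = T"
proof -
  define W where "W = (krylov S last_axis :: ('k, 'k) cmat)"
  obtain W' where W': "W ** W' = Finite_Cartesian_Product.mat 1" "W' ** W = Finite_Cartesian_Product.mat 1"
    using invertible_krylov by (auto simp: invertible_def W_def)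
  define V where "V v = (krylov N v :: ('n, 'k) cmat)" for v
  let ?K = "{v. matpow N CARD('k) *v v = 0}"
  have SW: "S ** W = W ** shift"
    using krylov_shift[OF funpow_card_last_axis] by (simp add: W_def)
  have sol: "N ** (V v ** W') = (V v ** W') ** S" if "v \<in> ?K" for v
  proof -
    have "N ** V v = V v ** shift"
      using krylov_shift[of N v] that by (simp add: V_def matpow_mult_vec)
    then have "N ** (V v ** W') = V v ** (shift ** W')"
      by (metis matrix_mul_assoc)
    also have "shift ** W' = W' ** S"
      by (metis SW W' matrix_mul_assoc matrix_mul_lid matrix_mul_rid)
    finally show ?thesis by (simp add: matrix_mul_assoc)
  qed
  \<comment> \<open>Flattening the matrix to a coordinate vector puts both sides of \<open>F\<close>
    under the dimension theory of \<open>vec.dim\<close>.\<close>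
  define F where "F v = (\<chi> p. (herm C ** (V v ** W')) $ fst p $ snd p :: complex^('m \<times> 'k))" for v
  have V_add: "V (v + w) = V v + V w" for v w
    by (simp add: V_def krylov_def Finite_Cartesian_Product.vec_eq_iff matpow_mult_vec[symmetric]
        matrix_vector_right_distrib)
  have V_scale: "V (c *s v) $ i $ j = c * V v $ i $ j" for c v i j
    by (simp add: V_def krylov_def matpow_mult_vec[symmetric] vector_scalar_commute)
  have lin: "Vector_Spaces.linear (*s) (*s) F"
    unfolding Vector_Spaces.linear_iff
    by (auto simp: vec.vector_space_axioms F_def Finite_Cartesian_Product.vec_eq_iff V_add
        matrix_add_ldistrib matrix_matrix_mult_def V_scale sum_distrib_left sum.distrib algebra_simps)
  \<comment> \<open>\<open>inj\<close> gives \<open>V v ** W' = 0\<close>; cancelling the invertible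
    \<open>W'\<close> leaves \<open>V v = 0\<close>, whose first column is \<open>v\<close>
    itself.\<close>
  have F_inj: "v = 0" if v: "v \<in> ?K" "F v = 0" for v
  proof -
    have "herm C ** (V v ** W') = 0"
      using v(2) by (auto simp: F_def Finite_Cartesian_Product.vec_eq_iff)
    then have "V v ** W' = 0"
      using inj sol[OF v(1)] by auto
    then have "V v ** (W' ** W) = 0"
      by (simp add: matrix_mul_assoc)
    then have "V v = 0" using W' by simp
    then have "V v $ i $ idx 0 = 0" for i by simp
    then show "v = 0"
      by (simp add: V_def krylov_def pos_idx Finite_Cartesian_Product.vec_eq_iff)
  qed
  have sub: "vec.subspace ?K"
    by (simp add: vec.subspace_def matrix_vector_right_distrib vector_scalar_commute)
  have "inj_on F ?K"
    using F_inj vec.linear_inj_on_iff_eq_0[OF lin sub] by blast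
  then have "vec.dim (F ` ?K) = CARD('m) * CARD('k)"
    using vec.dim_image_eq[OF lin, of ?K] dim sub by (simp add: vec.span_eq_iff[THEN iffD2])
  then have "vec.dim (F ` ?K) = vec.dim (UNIV :: (complex^('m \<times> 'k)) set)"
    by (simp add: vec.dim_UNIV card_cart_basis)
  moreover have "vec.subspace (F ` ?K)"
    using vec.linear_subspace_image[OF lin sub] .
  ultimately have "F ` ?K = UNIV"
    using vec.subspace_dim_equal[of "F ` ?K" UNIV] by auto
  then obtain v where v: "v \<in> ?K" "F v = (\<chi> p. T $ fst p $ snd p)"
    by (metis (no_types, lifting) UNIV_I imageE)
  have "herm C ** (V v ** W') = T"
    using v(2) by (auto simp: F_def Finite_Cartesian_Product.vec_eq_iff)
  then show ?thesis
    using sol[OF v(1)] by (intro exI[of _ "V v ** W'"]) auto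
qed

end

section \<open>Coordinates complementary to a surjective linear map\<close>

text \<open>Rank-nullity: a linear right inverse \<open>g\<close> of \<open>J\<close> splits every
  \<open>x\<close> into \<open>x - g (J x)\<close> in the kernel and \<open>g (J x)\<close> in the
  range of \<open>g\<close>.\<close>

lemma dim_kernel_surj:
  fixes J :: "complex^'a::finite \<Rightarrow> complex^'b::finite"
  assumes lin: "Vector_Spaces.linear (*s) (*s) J" and "surj J"
  shows "vec.dim {x. J x = 0} + CARD('b) = CARD('a)"
proof -
  let ?K = "{x. J x = 0}"
  interpret J: Vector_Spaces.linear "(*s)" "(*s)" J by (rule lin)
  obtain g where g: "Vector_Spaces.linear (*s) (*s) g" "J \<circ> g = id"
    using vec.linear_surjective_right_inverse[OF lin \<open>surj J\<close>] by blast
  have Jg: "J (g y) = y" for y using g(2) by (metis comp_apply id_apply)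
  have sub: "vec.subspace ?K"
    by (simp add: vec.subspace_def J.add J.scale)
  have sub': "vec.subspace (range g)"
    using vec.linear_subspace_image[OF g(1) vec.subspace_UNIV] .
  have "inj g" using Jg by (metis injI)
  then have "vec.dim (range g) = CARD('b)"
    using vec.dim_image_eq[OF g(1), of UNIV] by (simp add: card_cart_basis vec.dim_UNIV)
  moreover have "{x + y |x y. x \<in> ?K \<and> y \<in> range g} = UNIV"
  proof -
    have "x = (x - g (J x)) + g (J x) \<and> x - g (J x) \<in> ?K" for x
      by (simp add: J.diff Jg)
    then show ?thesis by blast
  qed
  moreover have "?K \<inter> range g = {0}"
    using Jg vec.linear_0[OF g(1)] J.zero by auto
  ultimately show ?thesis
    using vec.dim_sums_Int[OF sub sub'] by (simp add: card_cart_basis vec.dim_UNIV)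
qed

text \<open>The kernel of \<open>J\<close> has dimension \<open>CARD('z)\<close>, so some linear
  \<open>R\<close> is an isomorphism on it. Then \<open>J\<close> determines \<open>x\<close> up to
  the kernel, and \<open>R\<close> determines the rest.\<close>

lemma complementary_linear_map:
  fixes J :: "complex^'a::finite \<Rightarrow> complex^'b::finite"
  assumes lin: "Vector_Spaces.linear (*s) (*s) J" and "surj J"
    and card: "CARD('a) = CARD('b) + CARD('z::finite)"
  shows "\<exists>R :: complex^'a \<Rightarrow> complex^'z. Vector_Spaces.linear (*s) (*s) R \<and> bij (\<lambda>x. (J x, R x))"
proof -
  let ?K = "{x. J x = 0}"
  interpret J: Vector_Spaces.linear "(*s)" "(*s)" J by (rule lin)
  have sub: "vec.subspace ?K"
    by (simp add: vec.subspace_def J.add J.scale)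
  have "vec.dim ?K = vec.dim (UNIV :: (complex^'z) set)"
    using dim_kernel_surj[OF assms(1,2)] card by (simp add: card_cart_basis vec.dim_UNIV)
  then obtain R :: "complex^'a \<Rightarrow> complex^'z" where R: "Vector_Spaces.linear (*s) (*s) R"
    "R ` ?K = UNIV" "inj_on R ?K"
    using vec.subspace_isomorphism[OF sub vec.subspace_UNIV] by blast
  interpret R: Vector_Spaces.linear "(*s)" "(*s)" R by (rule R)
  have "inj (\<lambda>x. (J x, R x))"
  proof (rule injI)
    fix x y assume "(J x, R x) = (J y, R y)"
    then have "x - y \<in> ?K" "R (x - y) = R 0"
      by (auto simp: J.diff R.diff R.zero)
    moreover have "0 \<in> ?K" by (simp add: J.zero)
    ultimately show "x = y" using inj_onD[OF R(3), of "x - y" 0] by simp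
  qed
  moreover have "\<exists>x. y = J x \<and> z = R x" for y z
  proof -
    obtain x0 where x0: "J x0 = y" using \<open>surj J\<close> by (metis surjD)
    obtain k where "k \<in> ?K" "R k = z - R x0" using R(2) by (metis UNIV_I imageE)
    then show ?thesis using x0 by (intro exI[of _ "x0 + k"]) (simp add: J.add R.add)
  qed
  then have "surj (\<lambda>x. (J x, R x))"
    by (auto simp: surj_def)
  ultimately show ?thesis using R(1) by (auto simp: bij_def)
qed

section \<open>Complex scaling and flattening of the product spaces\<close>

abbreviation cscale :: "complex \<Rightarrow> ('p::finite, 'q::finite) cmat \<Rightarrow> ('p, 'q) cmat" where
  "cscale c M \<equiv> Finite_Cartesian_Product.mat c ** M"

lemma cscale_nth [simp]: "cscale c M $ i $ j = c * M $ i $ j"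
  by (simp add: matrix_matrix_mult_def Finite_Cartesian_Product.mat_def if_distrib if_distribR cong: if_cong)

text \<open>\<open>dom_scale\<close> and \<open>cod_scale\<close> are complex scalar multiplication
  on the domain and codomain of \<open>g_map\<close>. Complex linearity is expressed as additivity
  together with commuting with them.\<close>

definition dom_scale :: "complex \<Rightarrow> ('n::finite, 'n) cmat \<times> complex \<times> ('n, 'k::finite) cmat
    \<Rightarrow> ('n, 'n) cmat \<times> complex \<times> ('n, 'k) cmat" where
  "dom_scale c = (\<lambda>(G, l, X). (cscale c G, c * l, cscale c X))"

definition cod_scale :: "complex \<Rightarrow> ('n::finite, 'k::finite) cmat \<times> ('m::finite, 'k) cmat
    \<Rightarrow> ('n, 'k) cmat \<times> ('m, 'k) cmat" where
  "cod_scale c = (\<lambda>(Y, Z). (cscale c Y, cscale c Z))"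

text \<open>The identification with a coordinate space, which allows complex dimensions to be
  counted.\<close>

definition dom_flat :: "('n::finite, 'n) cmat \<times> complex \<times> ('n, 'k::finite) cmat
    \<Rightarrow> complex^('n \<times> 'n + unit + 'n \<times> 'k)" where
  "dom_flat = (\<lambda>(G, l, X). \<chi> p. case p of Inl (i, j) \<Rightarrow> G $ i $ j
     | Inr (Inl _) \<Rightarrow> l | Inr (Inr (i, j)) \<Rightarrow> X $ i $ j)"

definition dom_unflat :: "complex^('n \<times> 'n + unit + 'n \<times> 'k)
    \<Rightarrow> ('n::finite, 'n) cmat \<times> complex \<times> ('n, 'k::finite) cmat" where
  "dom_unflat x = (\<chi> i j. x $ Inl (i, j), x $ Inr (Inl ()), \<chi> i j. x $ Inr (Inr (i, j)))"

definition cod_flat :: "('n::finite, 'k::finite) cmat \<times> ('m::finite, 'k) cmat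
    \<Rightarrow> complex^('n \<times> 'k + 'm \<times> 'k)" where
  "cod_flat = (\<lambda>(Y, Z). \<chi> p. case p of Inl (i, j) \<Rightarrow> Y $ i $ j | Inr (i, j) \<Rightarrow> Z $ i $ j)"

lemma dom_unflat_flat [simp]: "dom_unflat (dom_flat e) = e"
  by (cases e) (simp add: dom_flat_def dom_unflat_def Finite_Cartesian_Product.vec_eq_iff)

lemma dom_flat_unflat [simp]: "dom_flat (dom_unflat x) = x"
  by (simp add: dom_flat_def dom_unflat_def Finite_Cartesian_Product.vec_eq_iff split: sum.split)

lemma dom_flat_linear: "dom_flat (e + e') = dom_flat e + dom_flat e'" "dom_flat (dom_scale c e) = c *s dom_flat e"
  by (cases e; cases e'; simp add: dom_flat_def dom_scale_def Finite_Cartesian_Product.vec_eq_iff split: sum.split)+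

lemma dom_unflat_linear: "dom_unflat (x + y) = dom_unflat x + dom_unflat y"
  "dom_unflat (c *s x) = dom_scale c (dom_unflat x)"
  by (simp_all add: dom_unflat_def dom_scale_def Finite_Cartesian_Product.vec_eq_iff)

lemma cod_flat_linear: "cod_flat (e + e') = cod_flat e + cod_flat e'" "cod_flat (cod_scale c e) = c *s cod_flat e"
  by (cases e; cases e'; simp add: cod_flat_def cod_scale_def Finite_Cartesian_Product.vec_eq_iff split: sum.split)+

definition cod_unflat :: "complex^('n \<times> 'k + 'm \<times> 'k)
    \<Rightarrow> ('n::finite, 'k::finite) cmat \<times> ('m::finite, 'k) cmat" where
  "cod_unflat y = (\<chi> i j. y $ Inl (i, j), \<chi> i j. y $ Inr (i, j))"

lemma cod_unflat_flat [simp]: "cod_unflat (cod_flat e) = e"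
  by (cases e) (simp add: cod_flat_def cod_unflat_def Finite_Cartesian_Product.vec_eq_iff)

lemma cod_flat_unflat [simp]: "cod_flat (cod_unflat y) = y"
  by (simp add: cod_flat_def cod_unflat_def Finite_Cartesian_Product.vec_eq_iff split: sum.split)

lemma complementary_coordinates:
  fixes J :: "('n::finite, 'n) cmat \<times> complex \<times> ('n, 'k::finite) cmat \<Rightarrow> ('n, 'k) cmat \<times> ('m::finite, 'k) cmat"
  assumes add: "\<And>e e'. J (e + e') = J e + J e'" and scale: "\<And>c e. J (dom_scale c e) = cod_scale c (J e)"
    and "surj J"
    and card: "CARD('n)\<^sup>2 + 1 = CARD('m) * CARD('k) + CARD('z::finite)"
  obtains R :: "('n, 'n) cmat \<times> complex \<times> ('n, 'k) cmat \<Rightarrow> complex^'z"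
  where "\<And>e e'. R (e + e') = R e + R e'" "\<And>c e. R (dom_scale c e) = c *s R e" "bij (\<lambda>e. (J e, R e))"
proof -
  let ?J = "\<lambda>x. cod_flat (J (dom_unflat x))"
  have "Vector_Spaces.linear (*s) (*s) ?J"
    by (simp add: Vector_Spaces.linear_iff vec.vector_space_axioms dom_unflat_linear add scale cod_flat_linear)
  moreover have "surj ?J"
    by (rule surjI[of _ "\<lambda>y. dom_flat (inv_into UNIV J (cod_unflat y))"]) (simp add: surj_f_inv_f[OF \<open>surj J\<close>])
  \<comment> \<open>Adding \<open>CARD('n) * CARD('k)\<close> to both sides of \<open>card\<close>
    gives the two flattened dimensions.\<close>
  moreover have "CARD('n \<times> 'n + unit + 'n \<times> 'k) = CARD('n \<times> 'k + 'm \<times> 'k) + CARD('z)"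
    using card by (simp add: power2_eq_square)
  ultimately obtain R :: "_ \<Rightarrow> complex^'z" where R: "Vector_Spaces.linear (*s) (*s) R" "bij (\<lambda>x. (?J x, R x))"
    using complementary_linear_map[where 'z='z] by blast
  interpret R: Vector_Spaces.linear "(*s)" "(*s)" R by (rule R)
  show thesis
  proof
    show "R (dom_flat (e + e')) = R (dom_flat e) + R (dom_flat e')" for e e'
      by (simp add: dom_flat_linear R.add)
    show "R (dom_flat (dom_scale c e)) = c *s R (dom_flat e)" for c e
      by (simp add: dom_flat_linear R.scale)
    show "bij (\<lambda>e. (J e, R (dom_flat e)))"
    proof (rule o_bij)
      let ?h = "inv_into UNIV (\<lambda>x. (?J x, R x))"
      have h: "?h (?J x, R x) = x" for x
        using inv_f_f[OF bij_is_inj[OF R(2)], of x] by simp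
      have h': "?J (?h p) = fst p" "R (?h p) = snd p" for p
        using surj_f_inv_f[OF bij_is_surj[OF R(2)], of p] by (simp_all add: prod_eq_iff)
      have h'': "J (dom_unflat (?h p)) = cod_unflat (fst p)" for p
        using arg_cong[OF h'(1)[of p], of cod_unflat] by (simp only: cod_unflat_flat)
      show "(\<lambda>p. dom_unflat (?h (cod_flat (fst p), snd p))) \<circ> (\<lambda>e. (J e, R (dom_flat e))) = id"
      proof
        fix e
        have "?h (cod_flat (J e), R (dom_flat e)) = dom_flat e"
          using h[of "dom_flat e"] by (simp only: dom_unflat_flat)
        then show "((\<lambda>p. dom_unflat (?h (cod_flat (fst p), snd p))) \<circ> (\<lambda>e. (J e, R (dom_flat e)))) e = id e"
          by (simp only: comp_apply fst_conv snd_conv dom_unflat_flat id_apply)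
      qed
      show "(\<lambda>e. (J e, R (dom_flat e))) \<circ> (\<lambda>p. dom_unflat (?h (cod_flat (fst p), snd p))) = id"
      proof
        fix p
        show "((\<lambda>e. (J e, R (dom_flat e))) \<circ> (\<lambda>p. dom_unflat (?h (cod_flat (fst p), snd p)))) p = id p"
          by (simp only: comp_apply h'' h'(2) dom_flat_unflat cod_unflat_flat fst_conv snd_conv id_apply prod.collapse)
      qed
    qed
  qed
qed

section \<open>Pseudoinverse and norms\<close>

text \<open>The witness is the least-squares inverse: \<open>Q\<close> inverts \<open>?H\<close>,
  the adjoint of \<open>L\<close> composed with \<open>L\<close>. This \<open>?H\<close> is
  injective because \<open>?H x \<bullet> x\<close> is the squared norm of
  \<open>L x\<close>.\<close>

lemma is_pseudoinverse_injective_exists: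
  fixes L :: "'a::euclidean_space \<Rightarrow> 'b::euclidean_space"
  assumes "linear L" "inj L"
  shows "\<exists>P. is_pseudoinverse L P"
proof -
  let ?H = "\<lambda>x. adjoint L (L x)"
  have adj: "adjoint L y \<bullet> x = y \<bullet> L x" for x y
    using adjoint_works[OF \<open>linear L\<close>, of x y] by (simp add: inner_commute)
  have linadj: "linear (adjoint L)" by (rule adjoint_linear[OF \<open>linear L\<close>])
  have linH: "linear ?H"
    using linear_compose[OF \<open>linear L\<close> linadj] by (simp add: comp_def)
  have "inj ?H"
    unfolding linear_injective_0[OF linH]
  proof (intro allI impI)
    fix x assume "?H x = 0"
    then have "L x \<bullet> L x = 0" using adj[of "L x" x] by simp
    then have "L x = 0" by simp
    then show "x = 0" using assms linear_injective_0 by blast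
  qed
  then obtain Q where Q: "linear Q" "\<And>x. Q (?H x) = x" "\<And>x. ?H (Q x) = x"
    using linear_injective_isomorphism[OF linH] by metis
  have sym: "?H x \<bullet> y = x \<bullet> ?H y" for x y
    using adj[of "L x" y] adj[of "L y" x] by (simp add: inner_commute)
  have Qsym: "Q x \<bullet> y = x \<bullet> Q y" for x y
    using sym[of "Q x" "Q y"] by (simp add: Q)
  have "is_pseudoinverse L (\<lambda>y. Q (adjoint L y))"
    unfolding is_pseudoinverse_def
  proof (intro conjI allI)
    show "linear (\<lambda>y. Q (adjoint L y))"
      using linear_compose[OF linadj Q(1)] by (simp add: comp_def)
    show "L (Q (adjoint L y)) \<bullet> y' = y \<bullet> L (Q (adjoint L y'))" for y y'
    proof -
      have "L (Q (adjoint L y)) \<bullet> y' = Q (adjoint L y) \<bullet> adjoint L y'"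
        using adj[of y' "Q (adjoint L y)"] by (simp add: inner_commute)
      also have "\<dots> = adjoint L y \<bullet> Q (adjoint L y')" by (rule Qsym)
      also have "\<dots> = y \<bullet> L (Q (adjoint L y'))" by (rule adj)
      finally show ?thesis .
    qed
  qed (simp_all add: Q)
  then show ?thesis by blast
qed

lemma is_pseudoinverse_left_inverse:
  assumes "is_pseudoinverse L P" "inj L"
  shows "P (L x) = x"
  using assms by (auto simp: is_pseudoinverse_def dest: injD)

text \<open>Both \<open>L P\<close> and \<open>L Q\<close> are the orthogonal projection onto the
  range of \<open>L\<close>; injectivity then cancels \<open>L\<close>.\<close>

lemma is_pseudoinverse_injective_unique:
  assumes P: "is_pseudoinverse L P" and Q: "is_pseudoinverse L Q" and "inj L"
  shows "P = Q"
proof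
  fix y
  have LPL: "L (P (L x)) = L x" "L (Q (L x)) = L x" for x
    using P Q by (auto simp: is_pseudoinverse_def)
  have sym: "L (P y) \<bullet> z = y \<bullet> L (P z)" "L (Q y) \<bullet> z = y \<bullet> L (Q z)" for y z
    using P Q by (auto simp: is_pseudoinverse_def)
  have "L (P y) \<bullet> z = L (Q y) \<bullet> z" for z
  proof -
    have "L (P y) \<bullet> z = L (Q (L (P y))) \<bullet> z" by (simp add: LPL)
    also have "\<dots> = y \<bullet> L (P (L (Q z)))" by (simp add: sym)
    also have "\<dots> = L (Q y) \<bullet> z" by (simp add: LPL sym)
    finally show ?thesis .
  qed
  then have "L (P y) = L (Q y)"
    by (metis vector_eq_rdot)
  then show "P y = Q y" using \<open>inj L\<close> by (auto dest: injD)
qed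

lemma pseudoinverse_injective:
  fixes L :: "'a::euclidean_space \<Rightarrow> 'b::euclidean_space"
  assumes "linear L" "inj L"
  shows "linear (pseudoinverse L)" "pseudoinverse L (L x) = x"
proof -
  have "is_pseudoinverse L (pseudoinverse L)"
    unfolding pseudoinverse_def
    using is_pseudoinverse_injective_exists[OF assms] is_pseudoinverse_injective_unique[OF _ _ assms(2)]
    by (metis theI)
  then show "linear (pseudoinverse L)" "pseudoinverse L (L x) = x"
    using is_pseudoinverse_left_inverse assms(2) by (auto simp: is_pseudoinverse_def)
qed

lemma operator_norm_eq_onorm:
  assumes "bounded_linear f"
  shows "operator_norm f = ereal (onorm f)"
proof -
  have bdd: "bdd_above (range (\<lambda>x. norm (f x) / norm x))"
    by (rule bdd_aboveI2[of _ _ "onorm f"]) (metis assms le_onorm)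
  have "operator_norm f \<le> ereal (onorm f)"
    unfolding operator_norm_def by (intro SUP_least) (simp add: le_onorm[OF assms])
  \<comment> \<open>The vector 0 contributes the quotient 0, which rules out minus infinity.\<close>
  moreover have "(0::ereal) \<le> operator_norm f"
    unfolding operator_norm_def by (intro SUP_upper2[of 0]) auto
  ultimately have "\<bar>operator_norm f\<bar> \<noteq> \<infinity>" by auto
  then show ?thesis
    unfolding operator_norm_def onorm_def by (rule ereal_SUP[symmetric])
qed

text \<open>For \<open>Y = G ** X\<close>, moving \<open>X\<close> across the inner product bounds
  the squared norm of \<open>Y\<close> by \<open>norm G * norm (Y ** herm X)\<close>, and
  orthonormality makes the last factor \<open>norm Y\<close>.\<close>

lemma norm_mult_orthonormal_columns_le:
  assumes "orthonormal_columns X"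
  shows "norm (G ** X) \<le> norm (G :: ('n::finite, 'p::finite) cmat)"
proof -
  have adj: "(G ** X) \<bullet> Y = G \<bullet> (Y ** herm X)" for G :: "('n, 'p) cmat" and Y
  proof -
    have "(G ** X) \<bullet> Y = (\<Sum>i\<in>UNIV. \<Sum>j\<in>UNIV. \<Sum>k\<in>UNIV. (G $ i $ k * X $ k $ j) \<bullet> Y $ i $ j)"
      by (simp add: inner_vec_def matrix_matrix_mult_def inner_sum_left)
    also have "\<dots> = (\<Sum>i\<in>UNIV. \<Sum>k\<in>UNIV. \<Sum>j\<in>UNIV. (G $ i $ k * X $ k $ j) \<bullet> Y $ i $ j)"
      by (intro sum.cong refl sum.swap)
    also have "\<dots> = (\<Sum>i\<in>UNIV. \<Sum>k\<in>UNIV. \<Sum>j\<in>UNIV. G $ i $ k \<bullet> (Y $ i $ j * cnj (X $ k $ j)))"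
      by (intro sum.cong refl) (simp add: inner_complex_def algebra_simps)
    also have "\<dots> = G \<bullet> (Y ** herm X)"
      by (simp add: inner_vec_def matrix_matrix_mult_def inner_sum_right herm_def)
    finally show ?thesis .
  qed
  let ?Y = "G ** X"
  have "(?Y ** herm X) \<bullet> (?Y ** herm X) = (?Y ** herm X ** X) \<bullet> ?Y"
    by (simp add: adj)
  also have "?Y ** herm X ** X = ?Y"
    using assms by (simp add: orthonormal_columns_def matrix_mul_assoc[symmetric])
  finally have eq: "norm (?Y ** herm X) = norm ?Y"
    by (simp add: norm_eq_sqrt_inner)
  have "norm ?Y * norm ?Y = G \<bullet> (?Y ** herm X)"
    by (simp add: adj[symmetric] power2_norm_eq_inner[symmetric] power2_eq_square)
  also have "\<dots> \<le> norm G * norm ?Y"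
    using norm_cauchy_schwarz[of G "?Y ** herm X"] eq by simp
  finally show ?thesis
    by (cases "norm ?Y = 0") (auto simp: mult_le_cancel_right)
qed

section \<open>Holomorphic parametrization of the zeros\<close>

lemma bounded_bilinear_matrix_mult:
  "bounded_bilinear (matrix_matrix_mult :: ('p::finite, 'q::finite) cmat \<Rightarrow> ('q, 'r::finite) cmat \<Rightarrow> _)"
proof -
  have "bilinear (matrix_matrix_mult :: ('p, 'q) cmat \<Rightarrow> ('q, 'r) cmat \<Rightarrow> _)"
    unfolding bilinear_def
  proof (intro conjI allI linearI)
    fix A A' :: "('p, 'q) cmat" and B B' :: "('q, 'r) cmat" and r :: real
    show "A ** (B + B') = A ** B + A ** B'" by (rule matrix_add_ldistrib)
    show "(A + A') ** B = A ** B + A' ** B" 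
      by (simp add: matrix_matrix_mult_def Finite_Cartesian_Product.vec_eq_iff sum.distrib algebra_simps)
    show "A ** (r *\<^sub>R B) = r *\<^sub>R (A ** B)" "(r *\<^sub>R A) ** B = r *\<^sub>R (A ** B)"
      by (simp_all add: matrix_matrix_mult_def Finite_Cartesian_Product.vec_eq_iff scaleR_sum_right)
  qed
  then show ?thesis by (simp add: bilinear_conv_bounded_bilinear)
qed

interpretation mm: bounded_bilinear "matrix_matrix_mult :: ('p::finite, 'q::finite) cmat \<Rightarrow> ('q, 'r::finite) cmat \<Rightarrow> _"
  by (rule bounded_bilinear_matrix_mult)

lemma bounded_linear_mat: "bounded_linear (Finite_Cartesian_Product.mat :: complex \<Rightarrow> ('n, 'n::finite) cmat)"
  unfolding linear_conv_bounded_linear[symmetric]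
  by (rule linearI) (simp_all add: Finite_Cartesian_Product.mat_def Finite_Cartesian_Product.vec_eq_iff)

lemmas mat_add = linear_add[OF bounded_linear.linear[OF bounded_linear_mat]]
lemmas mat_diff = linear_diff[OF bounded_linear.linear[OF bounded_linear_mat]]
lemmas mat_scaleR = linear_scale[OF bounded_linear.linear[OF bounded_linear_mat]]
lemmas mat_zero = linear_0[OF bounded_linear.linear[OF bounded_linear_mat]]

lemma mult_mat: "M ** Finite_Cartesian_Product.mat c = cscale c M"
  unfolding Finite_Cartesian_Product.vec_eq_iff cscale_nth
  by (simp add: matrix_matrix_mult_def Finite_Cartesian_Product.mat_def if_distrib cong: if_cong)

lemma cscale_mult: "cscale c A ** B = cscale c (A ** B)" "A ** cscale c B = cscale c (A ** B)"
  by (simp_all only: matrix_mul_assoc mult_mat)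

lemma mat_mult_eq_cscale: "Finite_Cartesian_Product.mat (c * l) = cscale c (Finite_Cartesian_Product.mat l)"
  by (simp add: Finite_Cartesian_Product.vec_eq_iff) (simp add: Finite_Cartesian_Product.mat_def)

lemma dom_scale_of_real: "dom_scale (complex_of_real r) e = r *\<^sub>R e"
  by (cases e) (simp add: dom_scale_def Finite_Cartesian_Product.vec_eq_iff, simp add: scaleR_conv_of_real)

lemma cod_scale_of_real: "cod_scale (complex_of_real r) e = r *\<^sub>R e"
  by (cases e) (simp add: cod_scale_def Finite_Cartesian_Product.vec_eq_iff, simp add: scaleR_conv_of_real)

section \<open>The Jacobian as the complex-linear derivative of \<open>g_map\<close>\<close>

lemma g_jac_add: "g_jac C S p (e + e') = g_jac C S p e + g_jac C S p e'"
  by (cases p; cases e; cases e') (simp add: g_jac_def mat_add mm.add_left mm.add_right mm.diff_left)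

lemma g_jac_scale: "g_jac C S p (dom_scale c e) = cod_scale c (g_jac C S p e)"
  by (cases p; cases e)
     (simp only: g_jac_def dom_scale_def cod_scale_def case_prod_conv mat_mult_eq_cscale cscale_mult
        mm.diff_right[symmetric] mm.add_right[symmetric])

lemma linear_g_jac: "linear (g_jac C S p)"
  by (rule linearI) (simp_all add: g_jac_add g_jac_scale flip: dom_scale_of_real cod_scale_of_real)

lemma g_map_has_derivative: "(g_map C S has_derivative g_jac C S p) (at p)"
proof -
  have eq: "g_map C S = (\<lambda>e. ((fst e - Finite_Cartesian_Product.mat (fst (snd e))) ** snd (snd e) - snd (snd e) ** S,
      herm C ** snd (snd e) - corner))"
    by (simp add: g_map_def fun_eq_iff)
  let ?T = "\<lambda>e. fst e - Finite_Cartesian_Product.mat (fst (snd e)) :: ('a, 'a) cmat"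
  have T: "bounded_linear ?T"
    by (intro bounded_linear_sub bounded_linear_fst bounded_linear_compose[OF bounded_linear_mat]
        bounded_linear_compose[OF bounded_linear_fst bounded_linear_snd])
  have X: "bounded_linear (\<lambda>e. snd (snd e))"
    by (rule bounded_linear_compose[OF bounded_linear_snd bounded_linear_snd])
  note deriv = bounded_linear_imp_has_derivative
  have "((\<lambda>e. ?T e ** snd (snd e)) has_derivative (\<lambda>h. ?T p ** snd (snd h) + ?T h ** snd (snd p))) (at p)"
    by (rule mm.FDERIV[OF deriv[OF T] deriv[OF X]])
  moreover have "((\<lambda>e. snd (snd e) ** S) has_derivative (\<lambda>h. snd (snd h) ** S)) (at p)"
    by (rule deriv[OF bounded_linear_compose[OF mm.bounded_linear_left X]])
  moreover have "((\<lambda>e. herm C ** snd (snd e)) has_derivative (\<lambda>h. herm C ** snd (snd h))) (at p)"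
    by (rule deriv[OF bounded_linear_compose[OF mm.bounded_linear_right X]])
  ultimately have "(g_map C S has_derivative (\<lambda>h. (?T p ** snd (snd h) + ?T h ** snd (snd p) - snd (snd h) ** S,
      herm C ** snd (snd h) - 0))) (at p)"
    unfolding eq by (intro has_derivative_Pair has_derivative_diff has_derivative_const)
  moreover have "g_jac C S p = (\<lambda>h. (?T p ** snd (snd h) + ?T h ** snd (snd p) - snd (snd h) ** S,
      herm C ** snd (snd h) - 0))"
    by (simp add: g_jac_def case_prod_beta fun_eq_iff add.commute)
  ultimately show ?thesis by simp
qed

text \<open>Continuity in the base point for each fixed direction suffices, since in finite
  dimension it yields continuity of the derivative in the operator norm.\<close>

lemma continuous_on_g_jac: "continuous_on UNIV (\<lambda>p. g_jac C S p e)"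
proof -
  have eq: "(\<lambda>p. g_jac C S p e) = (\<lambda>p. ((fst e - Finite_Cartesian_Product.mat (fst (snd e))) ** snd (snd p)
      + (fst p - Finite_Cartesian_Product.mat (fst (snd p))) ** snd (snd e) - snd (snd e) ** S, herm C ** snd (snd e)))"
    by (simp add: g_jac_def case_prod_beta)
  show ?thesis
    unfolding eq by (intro continuous_intros mm.continuous_on bounded_linear.continuous_on[OF bounded_linear_mat])
qed

lemma holomorphic_parametrization:
  fixes C :: "('n::{finite,wellorder}, 'm::{finite,wellorder}) cmat" and S :: "('k, 'k::{finite,wellorder}) cmat"
  assumes surj: "surj (g_jac C S p0)"
    and g0: "g_map C S p0 = 0"
    and card: "CARD('n)\<^sup>2 + 1 = CARD('m) * CARD('k) + CARD('z::finite)"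
  obtains U \<Omega> zs and e :: "complex^'z \<Rightarrow> ('n, 'n) cmat \<times> complex \<times> ('n, 'k) cmat"
  where "open U" "p0 \<in> U" "open \<Omega>" "zs \<in> \<Omega>" "e zs = p0"
    "\<And>z. z \<in> \<Omega> \<Longrightarrow> g_map C S (e z) = 0"
    "\<And>p. p \<in> U \<Longrightarrow> g_map C S p = 0 \<Longrightarrow> \<exists>z\<in>\<Omega>. p = e z"
    "\<And>z. z \<in> \<Omega> \<Longrightarrow> \<exists>D. (e has_derivative D) (at z) \<and> (\<forall>c v. D (c *s v) = dom_scale c (D v))"
proof -
  let ?J = "g_jac C S p0"
  obtain R :: "_ \<Rightarrow> complex^'z" where R_add: "\<And>e e'. R (e + e') = R e + R e'"
    and R_scale: "\<And>c e. R (dom_scale c e) = c *s R e" and bij: "bij (\<lambda>e. (?J e, R e))"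
    by (rule complementary_coordinates[OF g_jac_add g_jac_scale surj card]) (rule that)
  define M where "M = (\<lambda>e. (?J e, R e))"
  define M' where "M' = inv_into UNIV M"
  have bijM: "bij M" using bij by (simp add: M_def)
  have M'M: "M' (M e) = e" for e
    using bijM by (simp add: M'_def bij_is_inj)
  have MM': "M (M' y) = y" for y
    using bijM by (simp add: M'_def bij_is_surj surj_f_inv_f)
  have linR: "linear R"
  proof (rule linearI)
    show "R (r *\<^sub>R e) = r *\<^sub>R R e" for r e
      unfolding dom_scale_of_real[symmetric] R_scale
      by (simp add: Finite_Cartesian_Product.vec_eq_iff) (simp add: scaleR_conv_of_real)
  qed (rule R_add)
  have linM: "linear M"
    using linear_g_jac[of C S p0] linR
    by (intro linearI) (simp_all add: M_def linear_add linear_scale)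
  have linM': "linear M'"
  proof (rule linearI)
    show "M' (x + y) = M' x + M' y" for x y
      using M'M[of "M' x + M' y"] by (simp add: linear_add[OF linM] MM')
    show "M' (r *\<^sub>R x) = r *\<^sub>R M' x" for r x
      using M'M[of "r *\<^sub>R M' x"] by (simp add: linear_scale[OF linM] MM')
  qed
  then have blM': "bounded_linear M'" by (simp add: linear_conv_bounded_linear)
  have M'_scale: "M' (cod_scale c y, c *s w) = dom_scale c (M' (y, w))" for c y w
  proof -
    have "M (dom_scale c (M' (y, w))) = (cod_scale c (fst (M (M' (y, w)))), c *s snd (M (M' (y, w))))"
      unfolding M_def by (simp add: g_jac_scale R_scale)
    then show ?thesis by (metis M'M MM' fst_conv snd_conv)
  qed
  \<comment> \<open>Composing with \<open>M'\<close> makes \<open>f\<close> a self-map of the domain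
    whose derivative at \<open>p0\<close> is the identity, ready for the inverse function
    theorem.\<close>
  define f where "f = (\<lambda>p. M' (g_map C S p, R p))"
  define f' where "f' = (\<lambda>p. Blinfun (\<lambda>h. M' (g_jac C S p h, R h)))"
  have blR: "bounded_linear R" using linR by (simp add: linear_conv_bounded_linear)
  have bl: "bounded_linear (\<lambda>h. M' (g_jac C S p h, R h))" for p
    using linear_g_jac[of C S p] blR
    by (intro bounded_linear_compose[OF blM'] bounded_linear_Pair) (simp_all add: linear_conv_bounded_linear)
  have f': "blinfun_apply (f' p) = (\<lambda>h. M' (g_jac C S p h, R h))" for p
    unfolding f'_def by (rule bounded_linear_Blinfun_apply[OF bl])
  have derf: "(f has_derivative blinfun_apply (f' p)) (at p)" for p
    unfolding f' f_def
    by (intro bounded_linear.has_derivative[OF blM'] has_derivative_Pair g_map_has_derivative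
        bounded_linear_imp_has_derivative[OF blR])
  have contf: "continuous_on UNIV f'"
    by (intro continuous_on_blinfun_componentwise)
       (simp add: f' continuous_on_compose2[OF linear_continuous_on[OF blM', of UNIV]]
         continuous_on_Pair continuous_on_g_jac)
  have "id_blinfun o\<^sub>L f' p0 = id_blinfun"
    by (rule blinfun_eqI) (use M'M in \<open>simp add: f' M_def\<close>)
  then obtain U V h h' where U: "open U" "p0 \<in> U" "open V" "f p0 \<in> V" "homeomorphism U V f h"
    and derh: "\<And>y. y \<in> V \<Longrightarrow> (h has_derivative (h' y)) (at y)"
    and h': "\<And>y. y \<in> V \<Longrightarrow> h' y = inv_into UNIV (blinfun_apply (f' (h y)))"
    and bijh: "\<And>y. y \<in> V \<Longrightarrow> bij (blinfun_apply (f' (h y)))"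
    by (rule inverse_function_theorem[OF open_UNIV derf contf UNIV_I]) (rule that)
  \<comment> \<open>Zeros of \<open>g_map\<close> are exactly the points that \<open>f\<close> sends
    into the slice \<open>M' (0, z)\<close>; the local inverse \<open>h\<close> restricted to this
    slice is the parametrization.\<close>
  define \<Omega> where "\<Omega> = {z. M' (0, z) \<in> V}"
  define e where "e = (\<lambda>z. h (M' (0, z)))"
  have bl0: "bounded_linear (\<lambda>z. M' (0, z))"
    by (intro bounded_linear_compose[OF blM'] bounded_linear_Pair bounded_linear_zero bounded_linear_ident)
  have f0: "f p0 = M' (0, R p0)" by (simp add: f_def g0)
  show thesis
  proof
    show "open U" "p0 \<in> U" by fact+
    have "continuous_on UNIV (\<lambda>z. M' (0, z))"
      by (rule linear_continuous_on[OF bl0])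
    then show "open \<Omega>"
      unfolding \<Omega>_def using open_vimage[OF U(3), of "\<lambda>z. M' (0, z)"] by (simp add: vimage_def)
    show "R p0 \<in> \<Omega>" using U(4) by (simp add: \<Omega>_def f0)
    show "e (R p0) = p0"
      using U by (simp add: e_def f0[symmetric] homeomorphism_apply1)
    show "g_map C S (e z) = 0" if "z \<in> \<Omega>" for z
    proof -
      have "f (e z) = M' (0, z)"
        using that U(5) by (simp add: e_def \<Omega>_def homeomorphism_apply2)
      then have "(g_map C S (e z), R (e z)) = (0, z)"
        unfolding f_def by (metis MM')
      then show ?thesis by simp
    qed
    show "\<exists>z\<in>\<Omega>. p = e z" if "p \<in> U" "g_map C S p = 0" for p
    proof -
      have "f p = M' (0, R p)" by (simp add: f_def that)
      moreover have "f p \<in> V" "h (f p) = p"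
        using U(5) that(1) by (auto simp: homeomorphism_def)
      ultimately show ?thesis
        by (intro bexI[of _ "R p"]) (simp_all add: e_def \<Omega>_def)
    qed
    show "\<exists>D. (e has_derivative D) (at z) \<and> (\<forall>c v. D (c *s v) = dom_scale c (D v))" if "z \<in> \<Omega>" for z
    proof (intro exI conjI allI)
      let ?y = "M' (0, z)"
      have y: "?y \<in> V" using that by (simp add: \<Omega>_def)
      show "(e has_derivative (\<lambda>v. h' ?y (M' (0, v)))) (at z)"
        unfolding e_def
        by (rule has_derivative_compose[OF bounded_linear_imp_has_derivative[OF bl0] derh[OF y]])
      fix c v
      let ?F = "blinfun_apply (f' (h ?y))"
      have h'F: "h' ?y (?F u) = u" and Fh': "?F (h' ?y u) = u" for u
        using bijh[OF y] h'[OF y] by (simp_all add: bij_is_inj bij_is_surj surj_f_inv_f)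
      \<comment> \<open>The derivative of \<open>f\<close> commutes with complex scaling, hence so
        does its inverse \<open>h'\<close>; this is what makes \<open>e\<close> holomorphic.\<close>
      have F_scale: "?F (dom_scale c u) = dom_scale c (?F u)" for u
        by (simp add: f' g_jac_scale R_scale M'_scale)
      have "M' (0, c *s v) = dom_scale c (M' (0, v))"
        using M'_scale[of c 0 v] by (simp add: cod_scale_def zero_prod_def)
      also have "\<dots> = ?F (dom_scale c (h' ?y (M' (0, v))))"
        by (simp only: F_scale Fh')
      finally show "h' ?y (M' (0, c *s v)) = dom_scale c (h' ?y (M' (0, v)))"
        by (simp only: h'F)
    qed
  qed
qed

section \<open>Zeros over nearby matrices\<close>

lemma linear_g_partial_jac: "linear (g_partial_jac C S (A, lam, X))"
  by (rule linearI)
     (auto simp: g_partial_jac_def mat_add mm.add_left mm.add_right mm.diff_left algebra_simps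
        mat_scaleR mm.scaleR_left mm.scaleR_right)

text \<open>\<open>?L\<close> is bounded below by some \<open>c > 0\<close>. A perturbation of the
  matrix that is small against \<open>c\<close> preserves injectivity and moves the solution only
  slightly.\<close>

lemma nearby_zeros_of_g_map:
  fixes A :: "('n, 'n::{finite,wellorder}) cmat"
    and C :: "('n, 'm::{finite,wellorder}) cmat" and S :: "('k, 'k::{finite,wellorder}) cmat"
  assumes upper: "strictly_upper_triangular S" and super: "superdiagonal_prod S \<noteq> 0"
    and gz: "g_map C S (A, lam, X) = 0"
    and inj: "inj (g_partial_jac C S (A, lam, X))"
    and U: "open U" "(A, lam, X) \<in> U"
  obtains \<Phi> where "open \<Phi>" "(A, lam) \<in> \<Phi>"
    "\<And>B \<mu>. (B, \<mu>) \<in> \<Phi> \<Longrightarrow> multiplicity_support B \<mu> CARD('m) CARD('k) \<Longrightarrow>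
      \<exists>Y. (B, \<mu>, Y) \<in> U \<and> g_map C S (B, \<mu>, Y) = 0"
proof -
  let ?L = "g_partial_jac C S (A, lam, X)"
  obtain c where c: "c > 0" "\<And>x. c * norm x \<le> norm (?L x)"
    using linear_inj_bounded_below_pos[OF linear_g_partial_jac inj] by metis
  obtain K where K: "K > 0" "\<And>(P :: ('n, 'n) cmat) (Y :: ('n, 'k) cmat). norm (P ** Y) \<le> norm P * norm Y * K"
    using mm.pos_bounded by blast
  obtain r where r: "r > 0" "ball (A, lam, X) r \<subseteq> U"
    using U open_contains_ball by blast
  let ?E = "\<lambda>p. fst p - A - Finite_Cartesian_Product.mat (snd p - lam) :: ('n, 'n) cmat"
  \<comment> \<open>The first two conditions keep \<open>B\<close> and \<open>\<mu>\<close> within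
    \<open>r / 3\<close>. The third makes the perturbation at most half of what \<open>c\<close>
    tolerates, and the fourth brings the solution within \<open>r / 3\<close> of
    \<open>X\<close>.\<close>
  define \<Phi> where "\<Phi> = {p. norm (fst p - A) < r / 3} \<inter> {p. norm (snd p - lam) < r / 3} \<inter>
     {p. 2 * (K * norm (?E p)) < c} \<inter> {p. 2 * (K * norm (?E p)) * norm X < c * (r / 3)}"
  show thesis
  proof
    have "continuous_on UNIV (\<lambda>p. Finite_Cartesian_Product.mat (snd p - lam) :: ('n, 'n) cmat)"
      by (intro continuous_intros bounded_linear.continuous_on[OF bounded_linear_mat])
    then show "open \<Phi>"
      unfolding \<Phi>_def by (intro open_Int open_Collect_less continuous_intros)
    have "Finite_Cartesian_Product.mat (0 :: complex) = (0 :: ('n, 'n) cmat)"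
      using mat_zero by simp
    then show "(A, lam) \<in> \<Phi>"
      using r c by (simp add: \<Phi>_def)
    fix B \<mu> assume in\<Phi>: "(B, \<mu>) \<in> \<Phi>" and ms: "multiplicity_support B \<mu> CARD('m) CARD('k)"
    let ?N = "B - Finite_Cartesian_Product.mat \<mu>" and ?\<Delta> = "?E (B, \<mu>)"
    have N: "?N = (A - Finite_Cartesian_Product.mat lam) + ?\<Delta>"
      by (simp add: mat_diff)
    \<comment> \<open>At eigenvalue increment 0, \<open>?L\<close> is the equation for
      \<open>(B, \<mu>)\<close> up to the error \<open>?\<Delta> ** Y\<close>.\<close>
    have L: "?L (0, Y) = (?N ** Y - Y ** S - ?\<Delta> ** Y, herm C ** Y)" for Y
      unfolding N mm.add_left by (simp add: g_partial_jac_def mat_zero)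
    have small: "norm (?\<Delta> ** Y) \<le> K * norm ?\<Delta> * norm Y" for Y :: "('n, 'k) cmat"
      using K(2)[of ?\<Delta> Y] by (simp add: mult_ac)
    have le: "2 * (K * norm ?\<Delta>) < c" "2 * (K * norm ?\<Delta>) * norm X < c * (r / 3)"
      using in\<Phi> by (simp_all add: \<Phi>_def)
    have "Y = 0" if Y: "?N ** Y - Y ** S = 0" "herm C ** Y = 0" for Y
    proof (rule ccontr)
      assume "Y \<noteq> 0"
      have "c * norm Y \<le> norm (?L (0, Y))" using c(2)[of "(0, Y)"] by (simp add: norm_Pair)
      also have "\<dots> = norm (?\<Delta> ** Y)" unfolding L Y by (simp add: norm_Pair)
      also have "\<dots> \<le> K * norm ?\<Delta> * norm Y" by (rule small)
      finally have "c \<le> K * norm ?\<Delta>" using \<open>Y \<noteq> 0\<close> by (simp add: mult_le_cancel_right)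
      moreover have "K * norm ?\<Delta> \<ge> 0" using K(1) by simp
      ultimately show False using le(1) c(1) by linarith
    qed
    then obtain Y where Y: "?N ** Y - Y ** S = 0" "herm C ** Y = corner"
      using intertwining_solution_exists[OF upper super dim_kernel_power_if_multiplicity_support[OF ms], of C corner]
      by auto
    have "?L (0, Y - X) = ?L (0, Y) - ?L (0, X)"
      by (simp add: linear_diff[OF linear_g_partial_jac, symmetric])
    also have "?L (0, X) = (0, corner)"
      using gz by (simp add: g_map_def g_partial_jac_def zero_prod_def mat_zero)
    also have "?L (0, Y) = (- (?\<Delta> ** Y), corner)"
      unfolding L Y by simp
    finally have "norm (?L (0, Y - X)) = norm (?\<Delta> ** Y)"
      by (simp add: norm_Pair)
    then have "c * norm (Y - X) \<le> norm (?\<Delta> ** Y)"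
      using c(2)[of "(0, Y - X)"] by (simp add: norm_Pair)
    also have "\<dots> \<le> K * norm ?\<Delta> * norm Y" by (rule small)
    also have "\<dots> \<le> K * norm ?\<Delta> * (norm (Y - X) + norm X)"
      using K(1) norm_triangle_ineq[of "Y - X" X] by (intro mult_left_mono) auto
    finally have 1: "c * norm (Y - X) \<le> K * norm ?\<Delta> * norm (Y - X) + K * norm ?\<Delta> * norm X"
      by (simp add: algebra_simps)
    \<comment> \<open>Half of the left side of \<open>1\<close> absorbs the term containing
      \<open>norm (Y - X)\<close>.\<close>
    have 2: "2 * (K * norm ?\<Delta> * norm (Y - X)) \<le> c * norm (Y - X)"
      using mult_right_mono[OF less_imp_le[OF le(1)], of "norm (Y - X)"] by (simp add: mult_ac)
    have "c * norm (Y - X) < c * (r / 3)"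
      using 1 2 le(2) by (simp add: algebra_simps)
    then have "norm (Y - X) < r / 3" using c(1) by simp
    moreover have "norm (B - A) < r / 3" "norm (\<mu> - lam) < r / 3"
      using in\<Phi> by (simp_all add: \<Phi>_def)
    moreover have "norm ((B, \<mu>, Y) - (A, lam, X)) \<le> norm (B - A) + (norm (\<mu> - lam) + norm (Y - X))"
      using norm_Pair_le[of "B - A" "(\<mu> - lam, Y - X)"] norm_Pair_le[of "\<mu> - lam" "Y - X"] by simp
    ultimately have "norm ((B, \<mu>, Y) - (A, lam, X)) < r" by linarith
    then have "(B, \<mu>, Y) \<in> ball (A, lam, X) r"
      by (simp only: mem_ball dist_norm norm_minus_commute[of "(A, lam, X)"])
    then show "\<exists>Y. (B, \<mu>, Y) \<in> U \<and> g_map C S (B, \<mu>, Y) = 0"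
      using r(2) Y by (auto simp: g_map_def zero_prod_def)
  qed
qed

text \<open>Collecting the terms in \<open>a\<close> gives
  \<open>a * (1 - \<kappa> * K' * h) \<le> \<kappa> * (1 + K * h) * b\<close>. As \<open>h\<close>
  tends to 0, this yields \<open>a \<le> y' * b\<close> eventually for every
  \<open>y' > \<kappa>\<close>.\<close>

lemma Limsup_quotient_le:
  fixes a b h :: "'z \<Rightarrow> real"
  assumes "0 \<le> \<kappa>" and nonneg: "\<And>z. 0 \<le> a z" "\<And>z. 0 \<le> b z"
    and le: "eventually (\<lambda>z. a z \<le> \<kappa> * (b z + K * b z * h z + K' * a z * h z)) F"
    and h: "(h \<longlongrightarrow> 0) F"
  shows "Limsup F (\<lambda>z. ereal (a z) / ereal (b z)) \<le> ereal \<kappa>"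
  unfolding Limsup_le_iff
proof (intro allI impI)
  fix y assume "ereal \<kappa> < y"
  then obtain y' where y': "\<kappa> < y'" "ereal y' < y"
    using ereal_dense2 ereal_less_ereal_Ex by (metis less_ereal.simps(1))
  have "((\<lambda>z. 1 - \<kappa> * K' * h z) \<longlongrightarrow> 1 - \<kappa> * K' * 0) F"
    by (intro tendsto_intros h)
  then have ev1: "eventually (\<lambda>z. 0 < 1 - \<kappa> * K' * h z) F"
    by (rule order_tendstoD) simp
  have "((\<lambda>z. y' * (1 - \<kappa> * K' * h z) - \<kappa> * (1 + K * h z)) \<longlongrightarrow> y' * (1 - \<kappa> * K' * 0) - \<kappa> * (1 + K * 0)) F"
    by (intro tendsto_intros h)
  then have ev2: "eventually (\<lambda>z. 0 < y' * (1 - \<kappa> * K' * h z) - \<kappa> * (1 + K * h z)) F"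
    by (rule order_tendstoD) (use y' in simp)
  show "eventually (\<lambda>z. ereal (a z) / ereal (b z) < y) F"
    using ev1 ev2 le
  proof eventually_elim
    case (elim z)
    let ?q = "1 - \<kappa> * K' * h z"
    have "a z * ?q \<le> \<kappa> * (1 + K * h z) * b z"
      using elim(3) by (simp add: algebra_simps)
    also have "\<dots> \<le> y' * ?q * b z"
      using elim(2) nonneg(2) by (intro mult_right_mono) auto
    finally have "a z * ?q \<le> (y' * b z) * ?q"
      by (simp only: mult_ac)
    then have "a z \<le> y' * b z"
      using elim(1) by (rule mult_right_le_imp_le)
    have "ereal (a z) / ereal (b z) \<le> ereal y'"
    proof (cases "b z = 0")
      \<comment> \<open>Then \<open>a z\<close> vanishes as well, and the extended real quotient 0 /
        0 is 0.\<close>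
      case True
      then have "a z = 0" using \<open>a z \<le> y' * b z\<close> nonneg(1)[of z] by simp
      then show ?thesis using assms(1) y' by simp
    next
      case False
      then have "b z > 0" using nonneg(2)[of z] by simp
      then show ?thesis using \<open>a z \<le> y' * b z\<close> by (simp add: pos_divide_le_eq)
    qed
    then show ?case using y'(2) by order
  qed
qed

theorem theorem1:
  fixes A :: "('n, 'n::{finite,wellorder}) cmat"
    and lam :: complex
    and C :: "('n, 'm::{finite,wellorder}) cmat"
    and S :: "('k, 'k::{finite,wellorder}) cmat"
    and X :: "('n, 'k) cmat"
  assumes "multiplicity_support A lam CARD('m) CARD('k)"
    and "strictly_upper_triangular S"
    and "superdiagonal_prod S \<noteq> 0"
    and "proper_parameters A lam C S"
    and "g_map C S (A, lam, X) = 0"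
    and "orthonormal_columns X"
    and "CARD('z::finite) = CARD('n)^2 - CARD('m) * CARD('k) + 1"
  shows "(\<exists>(\<Phi> :: (('n, 'n) cmat \<times> complex) set) (\<Omega> :: (complex^'z) set) zs
             (G :: complex^'z \<Rightarrow> ('n, 'n) cmat) (l :: complex^'z \<Rightarrow> complex).
           open \<Phi> \<and> (A, lam) \<in> \<Phi> \<and> open \<Omega> \<and> zs \<in> \<Omega> \<and>
           holomorphic_several_mat G \<Omega> \<and> holomorphic_several l \<Omega> \<and>
           (A, lam) = (G zs, l zs) \<and>
           (\<forall>B \<mu>. (B, \<mu>) \<in> \<Phi> \<and> multiplicity_support B \<mu> CARD('m) CARD('k) \<longrightarrow>
              (\<exists>z\<in>\<Omega>. (B, \<mu>) = (G z, l z))) \<and>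
           Limsup (at zs) (\<lambda>z. ereal (norm (l z - lam)) / ereal (norm (G z - A)))
             \<le> operator_norm (pseudoinverse (g_partial_jac C S (A, lam, X))))
         \<and> operator_norm (pseudoinverse (g_partial_jac C S (A, lam, X))) < \<infinity>"
proof (intro conjI)
  obtain X' where X': "g_map C S (A, lam, X') = 0" "surj (g_jac C S (A, lam, X'))"
    "inj (g_partial_jac C S (A, lam, X'))"
    using assms(4) by (auto simp: proper_parameters_def)
  have "X' = X"
  proof -
    \<comment> \<open>At eigenvalue increment 0 the partial Jacobian does not depend on its base
      matrix, so it sends \<open>(0, X)\<close> and \<open>(0, X')\<close> to the same
      value.\<close>
    have eq: "g_partial_jac C S (A, lam, X') (0, Y) = (0, corner)" if "g_map C S (A, lam, Y) = 0" for Y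
      using that by (simp add: g_map_def g_partial_jac_def zero_prod_def mat_zero)
    show ?thesis
      using injD[OF X'(3)] eq[OF X'(1)] eq[OF assms(5)] by (metis prod.inject)
  qed
  then have surj: "surj (g_jac C S (A, lam, X))" and inj: "inj (g_partial_jac C S (A, lam, X))"
    using X' by simp_all
  let ?L = "g_partial_jac C S (A, lam, X)"
  define P where "P = pseudoinverse ?L"
  have P: "bounded_linear P" "P (?L x) = x" for x
    using pseudoinverse_injective[OF linear_g_partial_jac inj]
    by (simp_all add: P_def linear_conv_bounded_linear)
  define \<kappa> where "\<kappa> = onorm P"
  have \<kappa>: "operator_norm P = ereal \<kappa>" "0 \<le> \<kappa>" "norm (P y) \<le> \<kappa> * norm y" for y
    unfolding \<kappa>_def using operator_norm_eq_onorm[OF P(1)] onorm_pos_le[OF P(1)] onorm[OF P(1)] by blast+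
  show "operator_norm (pseudoinverse ?L) < \<infinity>"
    using \<kappa>(1) by (simp add: P_def)
  have dim: "vec.dim {v. matpow (A - Finite_Cartesian_Product.mat lam) CARD('k) *v v = 0} = CARD('m) * CARD('k)"
    using dim_kernel_power_if_multiplicity_support[OF assms(1)] by simp
  \<comment> \<open>\<open>m k\<close> is the dimension of a subspace of the
    \<open>n\<close>-dimensional space, so the natural-number subtraction in the assumption on
    \<open>CARD('z)\<close> does not truncate.\<close>
  have "CARD('m) * CARD('k) \<le> CARD('n)"
    using vec.dim_subset[of "{v. matpow (A - Finite_Cartesian_Product.mat lam) CARD('k) *v v = 0}" UNIV]
    by (simp add: dim vec.dim_UNIV card_cart_basis)
  also have "\<dots> \<le> CARD('n)\<^sup>2" by (simp add: power2_eq_square)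
  finally have card: "CARD('n)\<^sup>2 + 1 = CARD('m) * CARD('k) + CARD('z)"
    using assms(7) by simp
  obtain U \<Omega> zs and e :: "complex^'z \<Rightarrow> ('n, 'n) cmat \<times> complex \<times> ('n, 'k) cmat"
    where U: "open U" "(A, lam, X) \<in> U" and \<Omega>: "open \<Omega>" "zs \<in> \<Omega>" "e zs = (A, lam, X)"
    and zero: "\<And>z. z \<in> \<Omega> \<Longrightarrow> g_map C S (e z) = 0"
    and onto: "\<And>p. p \<in> U \<Longrightarrow> g_map C S p = 0 \<Longrightarrow> \<exists>z\<in>\<Omega>. p = e z"
    and der: "\<And>z. z \<in> \<Omega> \<Longrightarrow> \<exists>D. (e has_derivative D) (at z) \<and> (\<forall>c v. D (c *s v) = dom_scale c (D v))"
    by (rule holomorphic_parametrization[OF surj assms(5) card]) (rule that)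
  obtain \<Phi> where \<Phi>: "open \<Phi>" "(A, lam) \<in> \<Phi>"
    "\<And>B \<mu>. (B, \<mu>) \<in> \<Phi> \<Longrightarrow> multiplicity_support B \<mu> CARD('m) CARD('k) \<Longrightarrow>
      \<exists>Y. (B, \<mu>, Y) \<in> U \<and> g_map C S (B, \<mu>, Y) = 0"
    by (rule nearby_zeros_of_g_map[OF assms(2,3,5) inj U]) (rule that)
  define G where "G = (\<lambda>z. fst (e z))"
  define l where "l = (\<lambda>z. fst (snd (e z)))"
  define Y where "Y = (\<lambda>z. snd (snd (e z)))"
  have e: "e z = (G z, l z, Y z)" for z by (simp add: G_def l_def Y_def)
  have hol_l: "holomorphic_several l \<Omega>"
    unfolding holomorphic_several_def
  proof
    fix z assume "z \<in> \<Omega>"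
    then obtain D where D: "(e has_derivative D) (at z)" "\<And>c v. D (c *s v) = dom_scale c (D v)"
      using der by blast
    have "(l has_derivative (\<lambda>v. fst (snd (D v)))) (at z)"
      unfolding l_def by (intro has_derivative_fst has_derivative_snd D)
    then show "\<exists>D. (l has_derivative D) (at z) \<and> (\<forall>c v. D (c *s v) = c * D v)"
      by (intro exI conjI) (auto simp: D dom_scale_def case_prod_beta)
  qed
  have hol_G: "holomorphic_several_mat G \<Omega>"
    unfolding holomorphic_several_mat_def holomorphic_several_def
  proof (intro allI ballI)
    fix i j z assume "z \<in> \<Omega>"
    then obtain D where D: "(e has_derivative D) (at z)" "\<And>c v. D (c *s v) = dom_scale c (D v)"
      using der by blast
    have "((\<lambda>z. G z $ i $ j) has_derivative (\<lambda>v. fst (D v) $ i $ j)) (at z)"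
      unfolding G_def
      by (intro bounded_linear.has_derivative[OF bounded_linear_vec_nth] has_derivative_fst D)
    then show "\<exists>D. ((\<lambda>z. G z $ i $ j) has_derivative D) (at z) \<and> (\<forall>c v. D (c *s v) = c * D v)"
      by (intro exI conjI) (auto simp: D dom_scale_def case_prod_beta)
  qed
  \<comment> \<open>\<open>K\<close> and \<open>K'\<close> only multiply terms with the factor
    \<open>norm (Y z - X)\<close>, which vanish in the limit. The leading term has constant 1
    because \<open>X\<close> has orthonormal columns.\<close>
  obtain K where K: "K > 0" "\<And>(M :: ('n, 'n) cmat) (D :: ('n, 'k) cmat). norm (M ** D) \<le> norm M * norm D * K"
    using mm.pos_bounded by blast
  obtain K' where K': "K' > 0" "\<And>c (D :: ('n, 'k) cmat). norm (cscale c D) \<le> norm c * norm D * K'"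
    using bounded_bilinear.pos_bounded[OF bounded_bilinear.comp1[OF bounded_bilinear_matrix_mult bounded_linear_mat]]
    by blast
  have bound: "norm (l z - lam) \<le> \<kappa> * (norm (G z - A) + K * norm (G z - A) * norm (Y z - X)
      + K' * norm (l z - lam) * norm (Y z - X))" if z: "z \<in> \<Omega>" for z
  proof -
    let ?\<Delta> = "G z - A" and ?\<delta> = "l z - lam" and ?D = "Y z - X"
    have eqs: "G z ** Y z = cscale (l z) (Y z) + Y z ** S" "A ** X = cscale lam X + X ** S"
      "herm C ** Y z = herm C ** X"
      using zero[OF z] assms(5)
      by (simp_all add: e g_map_def zero_prod_def mm.diff_left algebra_simps)
    have "?L (?\<delta>, ?D) = (cscale ?\<delta> ?D - ?\<Delta> ** ?D - ?\<Delta> ** X, 0)"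
      by (simp add: g_partial_jac_def mm.diff_left mm.diff_right mat_diff eqs)
    then have "norm (?L (?\<delta>, ?D)) = norm (cscale ?\<delta> ?D - ?\<Delta> ** ?D - ?\<Delta> ** X)"
      by (simp add: norm_Pair)
    also have "\<dots> \<le> norm (cscale ?\<delta> ?D) + norm (?\<Delta> ** ?D) + norm (?\<Delta> ** X)"
      by (meson add_mono norm_triangle_ineq4 order_refl order_trans)
    also have "\<dots> \<le> norm ?\<delta> * norm ?D * K' + norm ?\<Delta> * norm ?D * K + norm ?\<Delta>"
      by (intro add_mono K K' norm_mult_orthonormal_columns_le assms(6))
    finally have *: "norm (?L (?\<delta>, ?D)) \<le> norm ?\<Delta> + K * norm ?\<Delta> * norm ?D + K' * norm ?\<delta> * norm ?D"
      by (simp add: mult_ac)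
    have "norm ?\<delta> \<le> norm (?\<delta>, ?D)" by (rule norm_fst_le)
    also have "\<dots> = norm (P (?L (?\<delta>, ?D)))" by (simp add: P(2))
    also have "\<dots> \<le> \<kappa> * norm (?L (?\<delta>, ?D))" by (rule \<kappa>(3))
    also have "\<dots> \<le> \<kappa> * (norm ?\<Delta> + K * norm ?\<Delta> * norm ?D + K' * norm ?\<delta> * norm ?D)"
      by (rule mult_left_mono[OF * \<kappa>(2)])
    finally show ?thesis .
  qed
  have "Limsup (at zs) (\<lambda>z. ereal (norm (l z - lam)) / ereal (norm (G z - A))) \<le> ereal \<kappa>"
  proof (rule Limsup_quotient_le)
    show "0 \<le> \<kappa>" by (rule \<kappa>)
    have "eventually (\<lambda>z. z \<in> \<Omega>) (at zs)"
      using \<Omega> by (intro eventually_at_topological[THEN iffD2]) blast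
    then show "eventually (\<lambda>z. norm (l z - lam) \<le> \<kappa> * (norm (G z - A) + K * norm (G z - A) * norm (Y z - X)
      + K' * norm (l z - lam) * norm (Y z - X))) (at zs)"
      by (rule eventually_mono) (rule bound)
    \<comment> \<open>Differentiability of \<open>e\<close> gives continuity, so \<open>Y z\<close>
      tends to \<open>X\<close> and the remainder terms disappear.\<close>
    have "isCont e zs"
      using der[OF \<Omega>(2)] has_derivative_continuous by blast
    then have "(e \<longlongrightarrow> (A, lam, X)) (at zs)"
      using \<Omega>(3) by (simp add: isCont_def)
    from tendsto_snd[OF tendsto_snd[OF this]] have "(Y \<longlongrightarrow> X) (at zs)"
      by (simp add: Y_def)
    then show "((\<lambda>z. norm (Y z - X)) \<longlongrightarrow> 0) (at zs)"
      by (simp add: LIM_zero tendsto_norm_zero)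
  qed auto
  moreover have "\<exists>z\<in>\<Omega>. (B, \<mu>) = (G z, l z)"
    if near: "(B, \<mu>) \<in> \<Phi>" "multiplicity_support B \<mu> CARD('m) CARD('k)" for B \<mu>
  proof -
    obtain Y' where "(B, \<mu>, Y') \<in> U" "g_map C S (B, \<mu>, Y') = 0"
      using \<Phi>(3)[OF near] by blast
    then obtain z where "z \<in> \<Omega>" "(B, \<mu>, Y') = e z" using onto by blast
    then show ?thesis by (auto simp: e)
  qed
  moreover have "(A, lam) = (G zs, l zs)"
    using \<Omega>(3) by (simp add: e)
  ultimately show "\<exists>(\<Phi> :: (('n, 'n) cmat \<times> complex) set) (\<Omega> :: (complex^'z) set) zs
             (G :: complex^'z \<Rightarrow> ('n, 'n) cmat) (l :: complex^'z \<Rightarrow> complex).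
           open \<Phi> \<and> (A, lam) \<in> \<Phi> \<and> open \<Omega> \<and> zs \<in> \<Omega> \<and>
           holomorphic_several_mat G \<Omega> \<and> holomorphic_several l \<Omega> \<and>
           (A, lam) = (G zs, l zs) \<and>
           (\<forall>B \<mu>. (B, \<mu>) \<in> \<Phi> \<and> multiplicity_support B \<mu> CARD('m) CARD('k) \<longrightarrow>
              (\<exists>z\<in>\<Omega>. (B, \<mu>) = (G z, l z))) \<and>
           Limsup (at zs) (\<lambda>z. ereal (norm (l z - lam)) / ereal (norm (G z - A)))
             \<le> operator_norm (pseudoinverse (g_partial_jac C S (A, lam, X)))"
    using \<Phi>(1,2) \<Omega>(1,2) hol_G hol_l \<kappa>(1) unfolding P_def[symmetric]
    by (intro exI[of _ \<Phi>] exI[of _ \<Omega>] exI[of _ zs] exI[of _ G] exI[of _ l]) auto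
qed

end
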